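(* Let $S=\{(\mathbf{x}^i,y^i)\}_{i=1}^n$ be i.i.d. from an (arbitrary, unknown) distribution $\mathbb{P}_{\mathbf{x},y}$ on $\mathcal{X}\times\mathcal{Y}$, and let $(\tilde{\mathbf{x}}^j,\tilde y^j)$, $j=1,\dots,m$, be i.i.d. from $\mathbb{P}_{\mathbf{x},y}$ and independent of $S$. Let $\mathcal{B}_0$ be a class of functions $\beta:\mathcal{X}\to\mathbb{R}$, let $0\le\delta_p\le\delta_q\le1$, and for $\tau\in\{\delta_p,\delta_q\}$ let $\beta^{\mathrm{Alg},\tau}\in\arg\min_{\beta\in\mathcal{B}_0}\frac1n\sum_{i=1}^n l^\tau(\beta(\mathbf{x}^i),y^i)$, where $l^\tau$ is the pinball loss. Define $$\mathcal{U}=\prod_{j=1}^m\Big[\min\big(\beta^{\mathrm{Alg},\delta_p}(\tilde{\mathbf{x}}^j),\beta^{\mathrm{Alg},\delta_q}(\tilde{\mathbf{x}}^j)\big),\ \max\big(\beta^{\mathrm{Alg},\delta_p}(\tilde{\mathbf{x}}^j),\beta^{\mathrm{Alg},\delta_q}(\tilde{\mathbf{x}}^j)\big)\Big],$$ and let $\pi^*$ be an optimal solution of the robust problem $$\min_{\pi\in\Pi}\max_{\mathbf{u}\in\mathcal{U}} f(\pi,\mathbf{u})\quad\text{s.t.}\quad F(\pi,\mathbf{u})\in\mathcal{K}\ \text{ for all }\mathbf{u}\in\mathcal{U}.$$ Let $\epsilon>0$ be a pre-determined constant. Then for every $\delta\in(0,1)$, with probability at least $1-\delta$ over the training sample $S$,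 $$\mathbb{P}_{\{\tilde{\mathbf{x}}^j,\tilde y^j\}_{j=1}^m}\Big(F(\pi^*,[\tilde y^1\cdots\tilde y^m]^T)\in\mathcal{K}\Big)\ \ge\ \left(\left[\frac1n\sum_{i=1}^n\Big(r^-_\epsilon(y^i-\beta^{\mathrm{Alg},\delta_q}(\mathbf{x}^i))-r^+_\epsilon(y^i-\beta^{\mathrm{Alg},\delta_p}(\mathbf{x}^i))\Big)-\frac8\epsilon\mathcal{R}(\mathcal{B}_0)-2\sqrt{\frac{\log\frac2\delta}{2n}}\right]_+\right)^m,$$ where $[\cdot]_+=\max(0,\cdot)$, $r^-_\epsilon(z)=\min\big(1,\max(0,-\tfrac z\epsilon)\big)$ and $r^+_\epsilon(z)=\min\big(1,\max(0,1-\tfrac z\epsilon)\big)$.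
   Context: $\mathcal{X}\subseteq\mathbb{R}^d$ is the feature space and $\mathcal{Y}\subseteq\mathbb{R}$ the label space. The pinball loss with parameter $\tau\in[0,1]$ is $l^\tau(\beta(\mathbf{x}),y)=\tau\,(y-\beta(\mathbf{x}))$ if $y-\beta(\mathbf{x})\ge0$ and $(\tau-1)(y-\beta(\mathbf{x}))$ otherwise. Decision problem: $\Pi\subseteq\mathbb{R}^{d_1}$ is the set of decisions, $f:\Pi\times\mathbb{R}^m\to\mathbb{R}$ the objective, $F:\Pi\times\mathbb{R}^m\to\mathbb{R}^{d_2}$ the constraint function, and $\mathcal{K}\subseteq\mathbb{R}^{d_2}$ a convex cone. The solution $\pi^*$ (assumed to exist) depends on $S$ and on $\tilde{\mathbf{x}}^1,\dots,\tilde{\mathbf{x}}^m$ through $\mathcal{U}$. Rademacher average: for a class $\mathcal{F}$ of real-valued functions and a sample $S'=\{z^i\}_{i=1}^n$, the empirical Rademacher average is $\mathcal{R}_{S'}(\mathcal{F})=\mathbb{E}_{\sigma^1,\dots,\sigma^n}\big[\frac1n\sup_{g\in\mathcal{F}}\big|\sum_{i=1}^n\sigma^i g(z^i)\big|\big]$, where the $\sigma^i$ are independent and equal to $\pm1$ with probability $1/2$ each. The Rademacher average is $\mathcal{R}(\mathcal{F})=\mathbb{E}[\mathcal{R}_{S'}(\mathcal{F})]$, the expectation being over the i.i.d. sample; for $\mathcal{R}(\mathcal{B}_0)$, $z^i=\mathbf{x}^i$. Convention: all sets, functions, suprema and data-dependent selections are taken to be measurable as needed for the probabilities and expectations to make sense.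 *)

theory Defs
  imports "HOL-Probability.Probability"
begin

definition pinball :: "real \<Rightarrow> real \<Rightarrow> real \<Rightarrow> real" where
  "pinball \<tau> b y = (if y - b \<ge> 0 then \<tau> * (y - b) else (\<tau> - 1) * (y - b))"

definition empirical_risk ::
  "real \<Rightarrow> nat \<Rightarrow> (nat \<Rightarrow> 'x \<times> real) \<Rightarrow> ('x \<Rightarrow> real) \<Rightarrow> real" where
  "empirical_risk \<tau> n S \<beta> = 1 / real n * (\<Sum>i<n. pinball \<tau> (\<beta> (fst (S i))) (snd (S i)))"

definition ramp_minus :: "real \<Rightarrow> real \<Rightarrow> real" where
  "ramp_minus \<epsilon> z = min 1 (max 0 (- (z / \<epsilon>)))"

definition ramp_plus :: "real \<Rightarrow> real \<Rightarrow> real" where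
  "ramp_plus \<epsilon> z = min 1 (max 0 (1 - z / \<epsilon>))"

definition uncertainty_box ::
  "('x \<Rightarrow> real) \<Rightarrow> ('x \<Rightarrow> real) \<Rightarrow> ('m::finite \<Rightarrow> 'x) \<Rightarrow> (real ^ 'm) set" where
  "uncertainty_box b\<^sub>p b\<^sub>q x =
     {u. \<forall>j. u $ j \<in> {min (b\<^sub>p (x j)) (b\<^sub>q (x j)) .. max (b\<^sub>p (x j)) (b\<^sub>q (x j))}}"

text \<open>
  The worst-case objective is a supremum in the extended reals: no continuity of the objective is
  assumed, and the supremum equals the maximum whenever the latter exists.
\<close>

definition robust_optimal ::
  "'p set \<Rightarrow> ('p \<Rightarrow> 'u \<Rightarrow> real) \<Rightarrow> ('p \<Rightarrow> 'u \<Rightarrow> 'k) \<Rightarrow> 'k set \<Rightarrow> 'u set \<Rightarrow> 'p \<Rightarrow> bool" where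
  "robust_optimal D f F K U =
     is_arg_min (\<lambda>\<pi>. SUP u\<in>U. ereal (f \<pi> u)) (\<lambda>\<pi>. \<pi> \<in> D \<and> (\<forall>u\<in>U. F \<pi> u \<in> K))"

text \<open>
  Rademacher averages take values in the extended nonnegative reals, so that classes with an
  unbounded supremum or a non-integrable one get the value infinity.
\<close>

definition emp_rademacher :: "nat \<Rightarrow> ('z \<Rightarrow> real) set \<Rightarrow> (nat \<Rightarrow> 'z) \<Rightarrow> ennreal" where
  "emp_rademacher n G z =
     (\<integral>\<^sup>+\<sigma>. ennreal (1 / real n) * (SUP g\<in>G. ennreal \<bar>\<Sum>i<n. \<sigma> i * g (z i)\<bar>)
        \<partial>measure_pmf (Pi_pmf {..<n} 0 (\<lambda>_. pmf_of_set {-1, 1 :: real})))"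

definition rademacher :: "'z measure \<Rightarrow> nat \<Rightarrow> ('z \<Rightarrow> real) set \<Rightarrow> ennreal" where
  "rademacher M n G = (\<integral>\<^sup>+z. emp_rademacher n G z \<partial>PiM {..<n} (\<lambda>_. M))"

text \<open>
  The measurability convention for (possibly uncountable) function classes: suprema over the class
  of weighted sums along a sample are measurable functions of the sample.
\<close>

definition measurable_suprema :: "'z measure \<Rightarrow> ('z \<Rightarrow> real) set \<Rightarrow> bool" where
  "measurable_suprema M G \<longleftrightarrow>
     (\<forall>N. \<forall>a :: nat \<Rightarrow> real.
        (\<lambda>z. SUP g\<in>G. ereal (\<Sum>i<N. a i * g (z i))) \<in> borel_measurable (PiM {..<N} (\<lambda>_. M)))"

end

theory Submission
  imports Defs
begin

text \<open>
  If every test label lies between the two fitted quantile functions at its feature vector, then the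
  label vector belongs to the uncertainty set, where a robust solution satisfies the constraint. For
  fixed training data the test points are independent, so the constraint holds with probability at
  least the \<open>m\<close>-th power of the probability \<open>p\<close> that a single label lies in its band
  (\<open>prob_product_event_ge\<close>). It remains to bound \<open>p\<close> from below by quantities computed on the training
  sample.
  
  The band has probability at least that of the labels below the upper function minus that of the
  labels below the lower one. Replacing the two indicators by the ramps, which err on the safe side, gives
  \<open>p \<ge> E[ramp_minus \<epsilon> (y - \<beta>\<^sub>q x)] - E[ramp_plus \<epsilon> (y - \<beta>\<^sub>p x)]\<close> (\<open>prob_band_ge_ramps\<close>). The predictors
  depend on the sample, so these expectations are compared with empirical means uniformly over the
  class \<open>B\<^sub>0\<close>. With probability \<open>1 - \<delta> / 2\<close> the one-sided uniform deviation for a class of functions with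
  range of length one is at most twice its Rademacher average plus \<open>sqrt (ln (2 / \<delta>) / (2 n))\<close>
  (\<open>uniform_deviation\<close>): McDiarmid's inequality (\<open>bounded_differences_tail\<close>) concentrates the deviation
  around its mean, and symmetrization with a ghost sample bounds the mean. Since the ramps are
  \<open>1 / \<epsilon>\<close>-Lipschitz, the contraction principle (\<open>rademacher_contraction\<close>) bounds the Rademacher averages
  of the two ramp classes by \<open>1 / \<epsilon>\<close> times that of \<open>B\<^sub>0\<close>. Two classes cost
  \<open>4 / \<epsilon>\<close> times the Rademacher average of \<open>B\<^sub>0\<close> in total, which is within the claimed \<open>8 / \<epsilon>\<close>.
\<close>

section \<open>McDiarmid's bounded differences inequality\<close>

text \<open>
  Coordinates are integrated out one at a time. Averaging over coordinate \<open>i\<close> leaves a function of the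
  other coordinates that inherits their difference bounds, and with the other coordinates held fixed
  the function of coordinate \<open>i\<close> is a bounded random variable, to which Hoeffding's lemma applies.
  The bound \<open>B\<close> makes all these integrals exist.
\<close>

lemma bounded_differences_mgf:
  fixes M :: "'i \<Rightarrow> 'a measure" and f :: "('i \<Rightarrow> 'a) \<Rightarrow> real"
  assumes "finite I" and M: "\<And>i. prob_space (M i)"
    and "f \<in> borel_measurable (PiM I M)"
    and "\<And>x. x \<in> space (PiM I M) \<Longrightarrow> \<bar>f x\<bar> \<le> B"
    and "\<And>i x y. i \<in> I \<Longrightarrow> x \<in> space (PiM I M) \<Longrightarrow> y \<in> space (M i) \<Longrightarrow>
           \<bar>f (x(i := y)) - f x\<bar> \<le> c i"
    and "l > 0"
  shows "(\<integral>\<^sup>+x. exp (l * (f x - (\<integral>z. f z \<partial>PiM I M))) \<partial>PiM I M)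
           \<le> ennreal (exp (l\<^sup>2 * (\<Sum>i\<in>I. (c i)\<^sup>2) / 8))"
  using assms(1,3-5)
proof (induction I arbitrary: f)
  case empty
  then show ?case
    by (simp add: PiM_empty nn_integral_count_space_finite lebesgue_integral_count_space_finite)
next
  case (insert i I)
  interpret product_sigma_finite M
    by (intro product_sigma_finite.intro prob_space_imp_sigma_finite M)
  interpret Mi: prob_space "M i" by (rule M)
  interpret PI: prob_space "PiM I M" by (intro prob_space_PiM M)
  interpret PiI: prob_space "PiM (insert i I) M" by (intro prob_space_PiM M)
  note f[measurable] = insert.prems(1) and bd = insert.prems(2) and diff = insert.prems(3)
  define \<mu> where "\<mu> = (\<integral>z. f z \<partial>PiM (insert i I) M)"
  define g where "g = (\<lambda>x. \<integral>y. f (x(i := y)) \<partial>M i)"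
  have upd: "x(i := y) \<in> space (PiM (insert i I) M)"
    if "x \<in> space (PiM I M)" "y \<in> space (M i)" for x y
    using that by (auto simp: space_PiM PiE_iff extensional_def)
  have fm: "(\<lambda>(x, y). f (x(i := y))) \<in> borel_measurable (PiM I M \<Otimes>\<^sub>M M i)"
    using measurable_comp[OF measurable_add_dim f] by (simp add: comp_def case_prod_beta')
  have fx[measurable]: "(\<lambda>y. f (x(i := y))) \<in> borel_measurable (M i)"
    if "x \<in> space (PiM I M)" for x
    using measurable_comp[OF measurable_component_update[OF that insert.hyps(2)] f]
    by (simp add: comp_def)
  have fint: "integrable (M i) (\<lambda>y. f (x(i := y)))" if "x \<in> space (PiM I M)" for x
    using that by (intro Mi.integrable_const_bound[of _ B] AE_I2 fx) (auto intro!: bd upd)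
  have g_meas[measurable]: "g \<in> borel_measurable (PiM I M)"
    unfolding g_def using fm by (intro sigma_finite_measure.borel_measurable_lebesgue_integral[OF prob_space_imp_sigma_finite[OF M]]) simp
  have g_bd: "\<bar>g x\<bar> \<le> B" if "x \<in> space (PiM I M)" for x
  proof -
    have "\<bar>g x\<bar> \<le> (\<integral>y. \<bar>f (x(i := y))\<bar> \<partial>M i)"
      unfolding g_def by (rule integral_abs_bound)
    also have "\<dots> \<le> (\<integral>y. B \<partial>M i)"
      using fint[OF that] that by (intro integral_mono) (auto intro!: bd upd)
    finally show ?thesis by (simp add: Mi.prob_space)
  qed
  have g_diff: "\<bar>g (x(j := z)) - g x\<bar> \<le> c j"
    if j: "j \<in> I" and x: "x \<in> space (PiM I M)" and z: "z \<in> space (M j)" for j x z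
  proof -
    have xz: "x(j := z) \<in> space (PiM I M)"
      using j x z by (auto simp: space_PiM PiE_iff extensional_def)
    have ij: "i \<noteq> j" using j insert.hyps by auto
    have "\<bar>g (x(j := z)) - g x\<bar> = \<bar>\<integral>y. f (x(j := z, i := y)) - f (x(i := y)) \<partial>M i\<bar>"
      unfolding g_def using fint[OF x] fint[OF xz] by simp
    also have "\<dots> \<le> (\<integral>y. \<bar>f (x(j := z, i := y)) - f (x(i := y))\<bar> \<partial>M i)"
      by (rule integral_abs_bound)
    also have "\<dots> \<le> (\<integral>y. c j \<partial>M i)"
    proof (intro integral_mono)
      fix y assume "y \<in> space (M i)"
      moreover have "x(j := z, i := y) = x(i := y, j := z)"
        using ij by (intro fun_upd_twist) auto
      ultimately show "\<bar>f (x(j := z, i := y)) - f (x(i := y))\<bar> \<le> c j"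
        using j z upd[OF x] by (simp only: diff insertI2)
    qed (use fint[OF x] fint[OF xz] in auto)
    finally show ?thesis by (simp add: Mi.prob_space)
  qed
  have f_int: "integrable (PiM (insert i I) M) f"
    by (intro PiI.integrable_const_bound[of _ B] AE_I2 f) (auto intro: bd)
  have g_mean: "(\<integral>x. g x \<partial>PiM I M) = \<mu>"
    unfolding \<mu>_def g_def by (rule product_integral_insert[symmetric]) (use insert.hyps f_int in auto)
  \<comment> \<open>Integrating out coordinate \<open>i\<close> alone costs the factor that Hoeffding's lemma gives for a
     variable confined to an interval of length \<open>c i\<close>.\<close>
  have inner: "(\<integral>\<^sup>+y. exp (l * (f (x(i := y)) - \<mu>)) \<partial>M i)
                 \<le> ennreal (exp (l\<^sup>2 * (c i)\<^sup>2 / 8)) * ennreal (exp (l * (g x - \<mu>)))"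
    if x: "x \<in> space (PiM I M)" for x
  proof -
    define a where "a = (INF y\<in>space (M i). f (x(i := y)))"
    have osc: "f (x(i := y)) - c i \<le> f (x(i := y'))"
      if "y \<in> space (M i)" "y' \<in> space (M i)" for y y'
      using diff[OF insertI1 upd[OF x that(2)] that(1)] unfolding fun_upd_upd by linarith
    have bb: "bdd_below ((\<lambda>y. f (x(i := y))) ` space (M i))"
      using bd upd[OF x] by (intro bdd_belowI[of _ "-B"]) (fastforce simp: abs_le_iff)
    have range: "f (x(i := y)) \<in> {a..a + c i}" if y: "y \<in> space (M i)" for y
    proof -
      have "f (x(i := y)) - c i \<le> a"
        unfolding a_def using osc[OF y] by (intro cINF_greatest) (auto simp: Mi.not_empty)
      moreover have "a \<le> f (x(i := y))"
        unfolding a_def using bb y by (rule cINF_lower)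
      ultimately show ?thesis by auto
    qed
    interpret interval_bounded_random_variable "M i" "\<lambda>y. f (x(i := y))" a "a + c i"
      by unfold_locales (use range fx[OF x] in auto)
    have "(\<integral>\<^sup>+y. exp (l * (f (x(i := y)) - \<mu>)) \<partial>M i) =
          (\<integral>\<^sup>+y. ennreal (exp (l * (g x - \<mu>))) * ennreal (exp (l * (f (x(i := y)) - g x))) \<partial>M i)"
      by (intro nn_integral_cong)
         (simp add: ennreal_mult[symmetric] exp_add[symmetric] algebra_simps)
    also have "\<dots> = ennreal (exp (l * (g x - \<mu>))) *
                     (\<integral>\<^sup>+y. ennreal (exp (l * (f (x(i := y)) - g x))) \<partial>M i)"
      using fx[OF x] by (intro nn_integral_cmult) simp
    also have "\<dots> \<le> ennreal (exp (l * (g x - \<mu>))) * ennreal (exp (l\<^sup>2 * (c i)\<^sup>2 / 8))"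
      using Hoeffdings_lemma_nn_integral[OF \<open>l > 0\<close>]
      by (intro mult_left_mono) (simp_all add: g_def)
    finally show ?thesis by (simp add: mult.commute)
  qed
  have "(\<integral>\<^sup>+x. exp (l * (f x - \<mu>)) \<partial>PiM (insert i I) M) =
        (\<integral>\<^sup>+x. (\<integral>\<^sup>+y. exp (l * (f (x(i := y)) - \<mu>)) \<partial>M i) \<partial>PiM I M)"
    using insert.hyps by (intro product_nn_integral_insert) auto
  also have "\<dots> \<le> (\<integral>\<^sup>+x. ennreal (exp (l\<^sup>2 * (c i)\<^sup>2 / 8)) * ennreal (exp (l * (g x - \<mu>))) \<partial>PiM I M)"
    by (intro nn_integral_mono inner)
  also have "\<dots> = ennreal (exp (l\<^sup>2 * (c i)\<^sup>2 / 8)) * (\<integral>\<^sup>+x. ennreal (exp (l * (g x - \<mu>))) \<partial>PiM I M)"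
    by (intro nn_integral_cmult) simp
  also have "\<dots> \<le> ennreal (exp (l\<^sup>2 * (c i)\<^sup>2 / 8)) * ennreal (exp (l\<^sup>2 * (\<Sum>i\<in>I. (c i)\<^sup>2) / 8))"
    using insert.IH[OF g_meas g_bd g_diff] by (intro mult_left_mono) (simp_all add: g_mean)
  also have "\<dots> = ennreal (exp (l\<^sup>2 * (\<Sum>i\<in>insert i I. (c i)\<^sup>2) / 8))"
    using insert.hyps by (simp add: ennreal_mult[symmetric] exp_add[symmetric] field_simps)
  finally show ?case by (simp add: \<mu>_def)
qed

text \<open>
  McDiarmid's inequality, by the Chernoff method applied to the exponential moment bound.
\<close>

lemma bounded_differences_tail:
  fixes M :: "'i \<Rightarrow> 'a measure" and f :: "('i \<Rightarrow> 'a) \<Rightarrow> real"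
  assumes I: "finite I" and M: "\<And>i. prob_space (M i)"
    and f[measurable]: "f \<in> borel_measurable (PiM I M)"
    and bd: "\<And>x. x \<in> space (PiM I M) \<Longrightarrow> \<bar>f x\<bar> \<le> B"
    and diff: "\<And>i x y. i \<in> I \<Longrightarrow> x \<in> space (PiM I M) \<Longrightarrow> y \<in> space (M i) \<Longrightarrow>
           \<bar>f (x(i := y)) - f x\<bar> \<le> c i"
    and t: "t > 0" and c: "(\<Sum>i\<in>I. (c i)\<^sup>2) > 0"
  shows "measure (PiM I M) {x \<in> space (PiM I M). f x \<ge> (\<integral>z. f z \<partial>PiM I M) + t}
           \<le> exp (- 2 * t\<^sup>2 / (\<Sum>i\<in>I. (c i)\<^sup>2))"
proof -
  interpret prob_space "PiM I M" by (intro prob_space_PiM M)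
  define C where "C = (\<Sum>i\<in>I. (c i)\<^sup>2)"
  define \<mu> where "\<mu> = (\<integral>z. f z \<partial>PiM I M)"
  \<comment> \<open>The minimiser of the exponent \<open>l\<^sup>2 * C / 8 - l * t\<close>.\<close>
  define l where "l = 4 * t / C"
  have l: "l > 0" using t c by (simp add: l_def C_def)
  have "emeasure (PiM I M) {x \<in> space (PiM I M). 1 \<le> ennreal (exp (- l * t)) * ennreal (exp (l * (f x - \<mu>)))}
        \<le> ennreal (exp (- l * t)) *
            (\<integral>\<^sup>+x. ennreal (exp (l * (f x - \<mu>))) * indicator (space (PiM I M)) x \<partial>PiM I M)"
    by (intro nn_integral_Markov_inequality) auto
  also have "(\<integral>\<^sup>+x. ennreal (exp (l * (f x - \<mu>))) * indicator (space (PiM I M)) x \<partial>PiM I M) =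
             (\<integral>\<^sup>+x. ennreal (exp (l * (f x - \<mu>))) \<partial>PiM I M)"
    by (intro nn_integral_cong) simp
  also have "ennreal (exp (- l * t)) * \<dots> \<le> ennreal (exp (- l * t)) * ennreal (exp (l\<^sup>2 * C / 8))"
    using bounded_differences_mgf[OF I M f bd diff l]
    by (intro mult_left_mono) (simp_all add: \<mu>_def C_def)
  also have "\<dots> = ennreal (exp (- l * t + l\<^sup>2 * C / 8))"
    by (simp add: ennreal_mult[symmetric] exp_add[symmetric])
  also have "- l * t + l\<^sup>2 * C / 8 = - 2 * t\<^sup>2 / C"
    using c by (simp add: l_def C_def[symmetric] field_simps power2_eq_square)
  also have "{x \<in> space (PiM I M). 1 \<le> ennreal (exp (- l * t)) * ennreal (exp (l * (f x - \<mu>)))} =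
             {x \<in> space (PiM I M). f x \<ge> \<mu> + t}"
  proof (intro Collect_cong conj_cong refl)
    fix x
    have "1 \<le> ennreal (exp (- l * t)) * ennreal (exp (l * (f x - \<mu>))) \<longleftrightarrow>
          ennreal 1 \<le> ennreal (exp (l * (f x - \<mu> - t)))"
      by (simp add: ennreal_mult[symmetric] exp_add[symmetric] algebra_simps)
    also have "\<dots> \<longleftrightarrow> 0 \<le> l * (f x - \<mu> - t)"
      by (subst ennreal_le_iff) auto
    also have "\<dots> \<longleftrightarrow> f x \<ge> \<mu> + t" using l by (auto simp: zero_le_mult_iff)
    finally show "(1 \<le> ennreal (exp (- l * t)) * ennreal (exp (l * (f x - \<mu>)))) = (f x \<ge> \<mu> + t)" .
  qed
  finally show ?thesis
    by (simp add: emeasure_eq_measure \<mu>_def C_def)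
qed

section \<open>The contraction principle for sign averages\<close>

text \<open>
  The value 0 outside \<open>{..<n}\<close> matches the default value of \<^const>\<open>Pi_pmf\<close> in \<^const>\<open>emp_rademacher\<close>,
  so that this set is the support of the distribution of the signs there.
\<close>

definition sign_vectors :: "nat \<Rightarrow> (nat \<Rightarrow> real) set" where
  "sign_vectors n = PiE_dflt {..<n} 0 (\<lambda>_. {-1, 1})"

lemma finite_sign_vectors [simp]: "finite (sign_vectors n)"
  unfolding sign_vectors_def by (intro finite_PiE_dflt) auto

lemma card_sign_vectors [simp]: "card (sign_vectors n) = 2 ^ n"
  unfolding sign_vectors_def by (subst card_PiE_dflt) (auto simp: numeral_2_eq_2)

lemma sign_vectors_nonempty [simp]: "sign_vectors n \<noteq> {}"
  unfolding sign_vectors_def by auto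

lemma sign_vectorsD: "\<sigma> \<in> sign_vectors n \<Longrightarrow> i < n \<Longrightarrow> \<sigma> i = - 1 \<or> \<sigma> i = 1"
  unfolding sign_vectors_def PiE_dflt_def by auto

lemma sum_uminus_sign_vectors:
  "(\<Sum>\<sigma>\<in>sign_vectors n. h (\<lambda>i. - \<sigma> i)) = (\<Sum>\<sigma>\<in>sign_vectors n. h \<sigma>)"
  by (rule sum.reindex_bij_witness[of _ "\<lambda>\<sigma> i. - \<sigma> i" "\<lambda>\<sigma> i. - \<sigma> i"])
     (auto simp: sign_vectors_def PiE_dflt_def)

lemma sum_flip_sign_vectors:
  assumes "j < n"
  shows "(\<Sum>\<sigma>\<in>sign_vectors n. h (\<sigma>(j := - \<sigma> j))) = (\<Sum>\<sigma>\<in>sign_vectors n. h \<sigma>)"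
  using assms
  by (intro sum.reindex_bij_witness[of _ "\<lambda>\<sigma>. \<sigma>(j := - \<sigma> j)" "\<lambda>\<sigma>. \<sigma>(j := - \<sigma> j)"])
     (auto simp: sign_vectors_def PiE_dflt_def)

text \<open>
  The contraction principle compares sums over all sign vectors of suprema. Here each supremum is
  replaced by an arbitrary choice \<open>s \<sigma>\<close> of an element for every sign vector, so that no supremum has
  to be finite. For one coordinate \<open>j\<close>, the sign vectors split into pairs that differ in the sign of
  \<open>j\<close> only. The two terms of a pair contain \<open>u j (s \<sigma>) - u j (s \<sigma>')\<close>, which is at most
  \<open>\<bar>v j (s \<sigma>) - v j (s \<sigma>')\<bar>\<close>; this absolute value is the \<open>v\<close>-difference itself either for the two
  choices as they are or after swapping them, and the swap leaves the other coordinates of the pair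
  sum alone because there the signs agree.
\<close>

lemma sign_selection_exchange_coordinate:
  fixes u v :: "nat \<Rightarrow> 'b \<Rightarrow> real"
  assumes j: "j < n"
    and eq: "\<And>i b. i \<noteq> j \<Longrightarrow> u i b = v i b"
    and dom: "\<And>b b'. b \<in> B \<Longrightarrow> b' \<in> B \<Longrightarrow> \<bar>u j b - u j b'\<bar> \<le> \<bar>v j b - v j b'\<bar>"
    and s: "s \<in> sign_vectors n \<rightarrow> B"
  obtains s' where "s' \<in> sign_vectors n \<rightarrow> B"
    "(\<Sum>\<sigma>\<in>sign_vectors n. \<Sum>i<n. \<sigma> i * u i (s \<sigma>)) \<le>
     (\<Sum>\<sigma>\<in>sign_vectors n. \<Sum>i<n. \<sigma> i * v i (s' \<sigma>))"
proof
  define flip :: "(nat \<Rightarrow> real) \<Rightarrow> nat \<Rightarrow> real" where "flip \<sigma> = \<sigma>(j := - \<sigma> j)" for \<sigma>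
  have flip_in: "flip \<sigma> \<in> sign_vectors n" if "\<sigma> \<in> sign_vectors n" for \<sigma>
    using that j by (auto simp: flip_def sign_vectors_def PiE_dflt_def)
  have flip_flip: "flip (flip \<sigma>) = \<sigma>" for \<sigma> by (simp add: flip_def)
  define s' where "s' \<sigma> = (if \<sigma> j * (v j (s \<sigma>) - v j (s (flip \<sigma>))) \<ge> 0 then s \<sigma> else s (flip \<sigma>))" for \<sigma>
  show "s' \<in> sign_vectors n \<rightarrow> B" using s flip_in by (auto simp: s'_def Pi_iff)
  define rest where "rest b \<sigma> = (\<Sum>i\<in>{..<n} - {j}. \<sigma> i * v i b)" for b \<sigma>
  have rest_flip: "rest b (flip \<sigma>) = rest b \<sigma>" for b \<sigma>
    unfolding rest_def flip_def by (intro sum.cong) auto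
  have split_v: "(\<Sum>i<n. \<sigma> i * v i b) = rest b \<sigma> + \<sigma> j * v j b" for \<sigma> b
    unfolding rest_def using j by (subst sum.remove[of _ j]) auto
  have split_u: "(\<Sum>i<n. \<sigma> i * u i b) = rest b \<sigma> + \<sigma> j * u j b" for \<sigma> b
  proof -
    have "(\<Sum>i<n. \<sigma> i * u i b) = \<sigma> j * u j b + (\<Sum>i\<in>{..<n} - {j}. \<sigma> i * u i b)"
      using j by (subst sum.remove[of _ j]) auto
    also have "(\<Sum>i\<in>{..<n} - {j}. \<sigma> i * u i b) = rest b \<sigma>"
      unfolding rest_def by (intro sum.cong) (auto simp: eq)
    finally show ?thesis by simp
  qed
  define U where "U \<sigma> = (\<Sum>i<n. \<sigma> i * u i (s \<sigma>))" for \<sigma>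
  define V where "V \<sigma> = (\<Sum>i<n. \<sigma> i * v i (s' \<sigma>))" for \<sigma>
  have pair: "U \<sigma> + U (flip \<sigma>) \<le> V \<sigma> + V (flip \<sigma>)" if \<sigma>: "\<sigma> \<in> sign_vectors n" for \<sigma>
  proof -
    have fj: "flip \<sigma> j = - \<sigma> j" by (simp add: flip_def)
    have U: "U \<sigma> + U (flip \<sigma>) =
        rest (s \<sigma>) \<sigma> + rest (s (flip \<sigma>)) \<sigma> + \<sigma> j * (u j (s \<sigma>) - u j (s (flip \<sigma>)))"
      by (simp add: U_def split_u rest_flip fj algebra_simps)
    have V: "V \<sigma> + V (flip \<sigma>) =
        rest (s' \<sigma>) \<sigma> + rest (s' (flip \<sigma>)) \<sigma> + \<sigma> j * (v j (s' \<sigma>) - v j (s' (flip \<sigma>)))"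
      by (simp add: V_def split_v rest_flip fj algebra_simps)
    have d: "\<bar>u j (s \<sigma>) - u j (s (flip \<sigma>))\<bar> \<le> \<bar>v j (s \<sigma>) - v j (s (flip \<sigma>))\<bar>"
      using s \<sigma> flip_in by (intro dom) auto
    have s'_eqs: "s' \<sigma> = (if \<sigma> j * (v j (s \<sigma>) - v j (s (flip \<sigma>))) \<ge> 0 then s \<sigma> else s (flip \<sigma>))"
      "s' (flip \<sigma>) = (if \<sigma> j * (v j (s \<sigma>) - v j (s (flip \<sigma>))) \<ge> 0 then s (flip \<sigma>) else s \<sigma>)"
      by (auto simp: s'_def fj flip_flip algebra_simps)
    show ?thesis
      using sign_vectorsD[OF \<sigma> j] d unfolding U V s'_eqs by auto
  qed
  have half: "2 * (\<Sum>\<sigma>\<in>sign_vectors n. h \<sigma>) = (\<Sum>\<sigma>\<in>sign_vectors n. h \<sigma> + h (flip \<sigma>))"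
    for h :: "(nat \<Rightarrow> real) \<Rightarrow> real"
    using sum_flip_sign_vectors[OF j, of h] by (simp add: sum.distrib flip_def)
  have "2 * (\<Sum>\<sigma>\<in>sign_vectors n. U \<sigma>) \<le> 2 * (\<Sum>\<sigma>\<in>sign_vectors n. V \<sigma>)"
    unfolding half by (intro sum_mono pair)
  then show "(\<Sum>\<sigma>\<in>sign_vectors n. \<Sum>i<n. \<sigma> i * u i (s \<sigma>)) \<le>
     (\<Sum>\<sigma>\<in>sign_vectors n. \<Sum>i<n. \<sigma> i * v i (s' \<sigma>))"
    by (simp add: U_def V_def)
qed

text \<open>
  The coordinates are converted from \<open>u\<close> to \<open>v\<close> in turn; \<open>w k\<close> is the stage at which the first \<open>k\<close>
  are done.
\<close>

lemma sign_selection_exchange: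
  fixes u v :: "nat \<Rightarrow> 'b \<Rightarrow> real"
  assumes dom: "\<And>i b b'. i < n \<Longrightarrow> b \<in> B \<Longrightarrow> b' \<in> B \<Longrightarrow> \<bar>u i b - u i b'\<bar> \<le> \<bar>v i b - v i b'\<bar>"
    and s: "s \<in> sign_vectors n \<rightarrow> B"
  shows "\<exists>s' \<in> sign_vectors n \<rightarrow> B.
    (\<Sum>\<sigma>\<in>sign_vectors n. \<Sum>i<n. \<sigma> i * u i (s \<sigma>)) \<le>
    (\<Sum>\<sigma>\<in>sign_vectors n. \<Sum>i<n. \<sigma> i * v i (s' \<sigma>))"
proof -
  define w where "w k i = (if i < k then v i else u i)" for k i :: nat
  have "\<exists>s' \<in> sign_vectors n \<rightarrow> B.
    (\<Sum>\<sigma>\<in>sign_vectors n. \<Sum>i<n. \<sigma> i * u i (s \<sigma>)) \<le>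
    (\<Sum>\<sigma>\<in>sign_vectors n. \<Sum>i<n. \<sigma> i * w k i (s' \<sigma>))" if "k \<le> n" for k
    using that
  proof (induction k)
    case 0
    then show ?case using s by (auto simp: w_def)
  next
    case (Suc k)
    then obtain s1 where s1: "s1 \<in> sign_vectors n \<rightarrow> B"
      "(\<Sum>\<sigma>\<in>sign_vectors n. \<Sum>i<n. \<sigma> i * u i (s \<sigma>)) \<le>
       (\<Sum>\<sigma>\<in>sign_vectors n. \<Sum>i<n. \<sigma> i * w k i (s1 \<sigma>))" by auto
    obtain s2 where "s2 \<in> sign_vectors n \<rightarrow> B"
      "(\<Sum>\<sigma>\<in>sign_vectors n. \<Sum>i<n. \<sigma> i * w k i (s1 \<sigma>)) \<le>
       (\<Sum>\<sigma>\<in>sign_vectors n. \<Sum>i<n. \<sigma> i * w (Suc k) i (s2 \<sigma>))"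
    proof (rule sign_selection_exchange_coordinate[of k n "w k" "w (Suc k)" B s1])
      show "\<bar>w k k b - w k k b'\<bar> \<le> \<bar>w (Suc k) k b - w (Suc k) k b'\<bar>" if "b \<in> B" "b' \<in> B" for b b'
        using dom[of k b b'] that Suc.prems by (simp add: w_def)
    qed (use Suc.prems s1 in \<open>auto simp: w_def less_Suc_eq\<close>)
    with s1(2) show ?case by (blast intro: order_trans)
  qed
  from this[of n] show ?thesis by (simp add: w_def)
qed

text \<open>
  The Ledoux-Talagrand contraction principle. Each supremum on the left is attained up to a small
  error by some choice, and a choice on the right is bounded by the supremum. The absolute values stand
  on the right only; with absolute values on both sides the principle would cost a factor 2 and
  hold only for contractions that fix 0. The bound \<open>C\<close> keeps the real-valued suprema on the left
  meaningful, while the right-hand side may be infinite.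
\<close>

lemma rademacher_contraction:
  fixes u b :: "nat \<Rightarrow> 'b \<Rightarrow> real"
  assumes B: "B \<noteq> {}" and L: "L \<ge> 0"
    and bd: "\<And>i \<beta>. i < n \<Longrightarrow> \<beta> \<in> B \<Longrightarrow> \<bar>u i \<beta>\<bar> \<le> C"
    and lip: "\<And>i \<beta> \<beta>'. i < n \<Longrightarrow> \<beta> \<in> B \<Longrightarrow> \<beta>' \<in> B \<Longrightarrow> \<bar>u i \<beta> - u i \<beta>'\<bar> \<le> L * \<bar>b i \<beta> - b i \<beta>'\<bar>"
  shows "ennreal (\<Sum>\<sigma>\<in>sign_vectors n. SUP \<beta>\<in>B. \<Sum>i<n. \<sigma> i * u i \<beta>)
           \<le> ennreal L * (\<Sum>\<sigma>\<in>sign_vectors n. SUP \<beta>\<in>B. ennreal \<bar>\<Sum>i<n. \<sigma> i * b i \<beta>\<bar>)"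
    (is "ennreal ?l \<le> ?r")
proof (rule ennreal_le_epsilon)
  fix e :: real assume e: "e > 0"
  (* The error is shared equally among the 2^n sign vectors. *)
  define e' where "e' = e / 2 ^ n"
  have e': "e' > 0" using e by (simp add: e'_def)
  have "\<exists>\<beta>\<in>B. (SUP \<beta>\<in>B. \<Sum>i<n. \<sigma> i * u i \<beta>) - e' < (\<Sum>i<n. \<sigma> i * u i \<beta>)"
    if \<sigma>: "\<sigma> \<in> sign_vectors n" for \<sigma>
  proof -
    have "(\<Sum>i<n. \<sigma> i * u i \<beta>) \<le> (\<Sum>i<n. C)" if "\<beta> \<in> B" for \<beta>
    proof (intro sum_mono)
      fix i assume "i \<in> {..<n}"
      then show "\<sigma> i * u i \<beta> \<le> C"
        using bd[OF _ that, of i] sign_vectorsD[OF \<sigma>, of i] by auto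
    qed
    then have "bdd_above ((\<lambda>\<beta>. \<Sum>i<n. \<sigma> i * u i \<beta>) ` B)" by (meson bdd_aboveI2)
    then show ?thesis using B e'
      by (subst less_cSUP_iff[symmetric]) auto
  qed
  then obtain s where s: "\<And>\<sigma>. \<sigma> \<in> sign_vectors n \<Longrightarrow> s \<sigma> \<in> B"
    "\<And>\<sigma>. \<sigma> \<in> sign_vectors n \<Longrightarrow>
       (SUP \<beta>\<in>B. \<Sum>i<n. \<sigma> i * u i \<beta>) - e' < (\<Sum>i<n. \<sigma> i * u i (s \<sigma>))"
    by metis
  have "\<exists>s' \<in> sign_vectors n \<rightarrow> B.
    (\<Sum>\<sigma>\<in>sign_vectors n. \<Sum>i<n. \<sigma> i * u i (s \<sigma>)) \<le>
    (\<Sum>\<sigma>\<in>sign_vectors n. \<Sum>i<n. \<sigma> i * (L * b i (s' \<sigma>)))"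
  proof (rule sign_selection_exchange)
    show "\<bar>u i \<beta> - u i \<beta>'\<bar> \<le> \<bar>L * b i \<beta> - L * b i \<beta>'\<bar>" if "i < n" "\<beta> \<in> B" "\<beta>' \<in> B" for i \<beta> \<beta>'
      using lip[OF that] L by (simp add: right_diff_distrib[symmetric] abs_mult)
  qed (use s in auto)
  then obtain s' where s': "s' \<in> sign_vectors n \<rightarrow> B"
    "(\<Sum>\<sigma>\<in>sign_vectors n. \<Sum>i<n. \<sigma> i * u i (s \<sigma>)) \<le>
     (\<Sum>\<sigma>\<in>sign_vectors n. \<Sum>i<n. \<sigma> i * (L * b i (s' \<sigma>)))" by blast
  have "?l \<le> (\<Sum>\<sigma>\<in>sign_vectors n. (\<Sum>i<n. \<sigma> i * u i (s \<sigma>)) + e')"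
    using s(2) by (intro sum_mono) force
  also have "\<dots> = (\<Sum>\<sigma>\<in>sign_vectors n. \<Sum>i<n. \<sigma> i * u i (s \<sigma>)) + e"
    by (simp add: sum.distrib e'_def)
  also have "\<dots> \<le> (\<Sum>\<sigma>\<in>sign_vectors n. \<Sum>i<n. \<sigma> i * (L * b i (s' \<sigma>))) + e"
    using s'(2) by simp
  also have "(\<Sum>\<sigma>\<in>sign_vectors n. \<Sum>i<n. \<sigma> i * (L * b i (s' \<sigma>))) =
             L * (\<Sum>\<sigma>\<in>sign_vectors n. \<Sum>i<n. \<sigma> i * b i (s' \<sigma>))"
    by (simp add: sum_distrib_left algebra_simps)
  also have "\<dots> \<le> L * (\<Sum>\<sigma>\<in>sign_vectors n. \<bar>\<Sum>i<n. \<sigma> i * b i (s' \<sigma>)\<bar>)"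
    using L by (intro mult_left_mono sum_mono) auto
  finally have "?l \<le> L * (\<Sum>\<sigma>\<in>sign_vectors n. \<bar>\<Sum>i<n. \<sigma> i * b i (s' \<sigma>)\<bar>) + e"
    by simp
  then have "ennreal ?l \<le> ennreal (L * (\<Sum>\<sigma>\<in>sign_vectors n. \<bar>\<Sum>i<n. \<sigma> i * b i (s' \<sigma>)\<bar>) + e)"
    by (rule ennreal_leI)
  also have "\<dots> = ennreal L * (\<Sum>\<sigma>\<in>sign_vectors n. ennreal \<bar>\<Sum>i<n. \<sigma> i * b i (s' \<sigma>)\<bar>) + ennreal e"
    using L e by (simp add: ennreal_plus ennreal_mult sum_nonneg)
  also have "\<dots> \<le> ?r + ennreal e"
    using s'(1) by (intro add_right_mono mult_left_mono sum_mono SUP_upper) auto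
  finally show "ennreal ?l \<le> ?r + ennreal e" .
qed

section \<open>Uniform deviation over a bounded function class\<close>

text \<open>
  The range \<open>{a..a + 1}\<close> allows both \<open>[0, 1]\<close>-valued functions and their negatives, which give the
  two one-sided deviations.
\<close>

locale bounded_function_class = prob_space M for M :: "'z measure" +
  fixes G :: "('z \<Rightarrow> real) set" and a :: real
  assumes nonempty: "G \<noteq> {}"
    and measurable_class: "G \<subseteq> borel_measurable M"
    and range_class: "g \<in> G \<Longrightarrow> g z \<in> {a..a + 1}"
    and suprema: "measurable_suprema M G"
begin

definition weighted_sup :: "nat \<Rightarrow> (nat \<Rightarrow> real) \<Rightarrow> (nat \<Rightarrow> 'z) \<Rightarrow> real" where
  "weighted_sup N w z = (SUP g\<in>G. \<Sum>i<N. w i * g (z i))"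

abbreviation sample :: "nat \<Rightarrow> (nat \<Rightarrow> 'z) measure" where
  "sample N \<equiv> PiM {..<N} (\<lambda>_. M)"

lemma prob_space_sample: "prob_space (PiM I (\<lambda>_. M))"
  by (intro prob_space_PiM) unfold_locales

lemma abs_class_le: "g \<in> G \<Longrightarrow> \<bar>g z\<bar> \<le> \<bar>a\<bar> + 1"
  using range_class[of g z] by auto

lemma abs_class_diff_le: "g \<in> G \<Longrightarrow> \<bar>g z - g z'\<bar> \<le> 1"
  using range_class[of g z] range_class[of g z'] by auto

lemma abs_weighted_sum_le:
  assumes "g \<in> G"
  shows "\<bar>\<Sum>i<N. w i * g (z i)\<bar> \<le> (\<Sum>i<N. \<bar>w i\<bar> * (\<bar>a\<bar> + 1))"
proof -
  have "\<bar>\<Sum>i<N. w i * g (z i)\<bar> \<le> (\<Sum>i<N. \<bar>w i * g (z i)\<bar>)" by (rule sum_abs)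
  also have "\<dots> \<le> (\<Sum>i<N. \<bar>w i\<bar> * (\<bar>a\<bar> + 1))"
    unfolding abs_mult using assms by (intro sum_mono mult_left_mono abs_class_le) auto
  finally show ?thesis .
qed

lemma weighted_sum_le:
  "g \<in> G \<Longrightarrow> (\<Sum>i<N. w i * g (z i)) \<le> (\<Sum>i<N. \<bar>w i\<bar> * (\<bar>a\<bar> + 1))"
  using abs_weighted_sum_le[of g w z N] by linarith

lemma bdd_above_weighted_sums: "bdd_above ((\<lambda>g. \<Sum>i<N. w i * g (z i)) ` G)"
  by (rule bdd_aboveI2[OF weighted_sum_le])

lemma weighted_sum_le_sup: "g \<in> G \<Longrightarrow> (\<Sum>i<N. w i * g (z i)) \<le> weighted_sup N w z"
  unfolding weighted_sup_def by (intro cSUP_upper bdd_above_weighted_sums)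

lemma weighted_sup_le: "(\<And>g. g \<in> G \<Longrightarrow> (\<Sum>i<N. w i * g (z i)) \<le> c) \<Longrightarrow> weighted_sup N w z \<le> c"
  unfolding weighted_sup_def using nonempty by (intro cSUP_least) auto

lemma abs_weighted_sup_le: "\<bar>weighted_sup N w z\<bar> \<le> (\<Sum>i<N. \<bar>w i\<bar> * (\<bar>a\<bar> + 1))"
proof -
  obtain g where g: "g \<in> G" using nonempty by auto
  have "weighted_sup N w z \<le> (\<Sum>i<N. \<bar>w i\<bar> * (\<bar>a\<bar> + 1))"
    by (intro weighted_sup_le weighted_sum_le)
  moreover have "- (\<Sum>i<N. \<bar>w i\<bar> * (\<bar>a\<bar> + 1)) \<le> weighted_sup N w z"
    using weighted_sum_le_sup[OF g, of w z N] abs_weighted_sum_le[OF g, of w z N] by linarith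
  ultimately show ?thesis by linarith
qed

lemma measurable_weighted_sup [measurable]: "weighted_sup N w \<in> borel_measurable (sample N)"
proof -
  have "weighted_sup N w = (\<lambda>z. real_of_ereal (SUP g\<in>G. ereal (\<Sum>i<N. w i * g (z i))))"
  proof
    fix z
    let ?S = "SUP g\<in>G. ereal (\<Sum>i<N. w i * g (z i))"
    have "?S \<le> ereal (weighted_sup N w z)"
      by (intro SUP_least) (simp add: weighted_sum_le_sup)
    moreover obtain g where "g \<in> G" using nonempty by auto
    then have "ereal (\<Sum>i<N. w i * g (z i)) \<le> ?S" by (intro SUP_upper)
    ultimately have "\<bar>?S\<bar> \<noteq> \<infinity>" by auto
    then have "?S = ereal (weighted_sup N w z)"
      unfolding weighted_sup_def by (rule ereal_SUP[symmetric])
    then show "weighted_sup N w z = real_of_ereal ?S" by simp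
  qed
  moreover have "(\<lambda>z. SUP g\<in>G. ereal (\<Sum>i<N. w i * g (z i))) \<in> borel_measurable (sample N)"
    using suprema unfolding measurable_suprema_def by blast
  ultimately show ?thesis
    by simp
qed

lemma integrable_weighted_sup: "integrable (sample N) (weighted_sup N w)"
proof -
  interpret S: prob_space "sample N" by (rule prob_space_sample)
  show ?thesis
    by (intro S.integrable_const_bound[OF AE_I2]) (use abs_weighted_sup_le in auto)
qed

lemma weighted_sup_update:
  assumes "j < N"
  shows "weighted_sup N w (z(j := y)) \<le> weighted_sup N w z + \<bar>w j\<bar>"
proof (rule weighted_sup_le)
  fix g assume g: "g \<in> G"
  have "(\<Sum>i<N. w i * g ((z(j := y)) i)) = w j * g y + (\<Sum>i\<in>{..<N} - {j}. w i * g (z i))"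
    using assms by (subst sum.remove[of _ j]) (auto intro!: sum.cong)
  also have "\<dots> = (\<Sum>i<N. w i * g (z i)) + w j * (g y - g (z j))"
    using assms by (subst (2) sum.remove[of _ j]) (auto simp: algebra_simps)
  also have "w j * (g y - g (z j)) \<le> \<bar>w j\<bar> * \<bar>g y - g (z j)\<bar>"
    by (metis abs_ge_self abs_mult)
  also have "\<dots> \<le> \<bar>w j\<bar> * 1"
    using g by (intro mult_left_mono abs_class_diff_le) auto
  finally show "(\<Sum>i<N. w i * g ((z(j := y)) i)) \<le> weighted_sup N w z + \<bar>w j\<bar>"
    using weighted_sum_le_sup[OF g, of w z N] by simp
qed

lemma abs_weighted_sup_update:
  assumes "j < N"
  shows "\<bar>weighted_sup N w (z(j := y)) - weighted_sup N w z\<bar> \<le> \<bar>w j\<bar>"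
  using weighted_sup_update[OF assms, of w z y] weighted_sup_update[OF assms, of w "z(j := y)" "z j"]
  by simp

text \<open>
  Permuting or selecting the points of an i.i.d. sample does not change its distribution. This is the
  only symmetry used: swaps of a sample point with its ghost, and restrictions to one half of a doubled
  sample.
\<close>

lemma integral_sample_reindex:
  assumes f: "inj_on f {..<N}" "f \<in> {..<N} \<rightarrow> {..<K}" and h: "h \<in> borel_measurable (sample N)"
  shows "(\<integral>z. h (\<lambda>i\<in>{..<N}. z (f i)) \<partial>sample K) = (\<integral>z. h z \<partial>sample N :: real)"
proof -
  have d: "distr (sample K) (sample N) (\<lambda>z. \<lambda>i\<in>{..<N}. z (f i)) = sample N"
    using distr_PiM_reindex[of "{..<K}" "\<lambda>_. M" f "{..<N}"] f prob_space_axioms by simp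
  have m: "(\<lambda>z. \<lambda>i\<in>{..<N}. z (f i)) \<in> sample K \<rightarrow>\<^sub>M sample N"
    using f(2) by (intro measurable_restrict measurable_component_singleton) auto
  have "(\<integral>z. h z \<partial>sample N) = (\<integral>z. h z \<partial>distr (sample K) (sample N) (\<lambda>z. \<lambda>i\<in>{..<N}. z (f i)))"
    by (simp add: d)
  also have "\<dots> = (\<integral>z. h (\<lambda>i\<in>{..<N}. z (f i)) \<partial>sample K)"
    by (rule integral_distr[OF m h])
  finally show ?thesis by simp
qed

text \<open>
  A sample \<open>S\<close> and an independent ghost sample are the two halves of one sample of size \<open>2 * n\<close>; with
  these weights a weighted sum is the difference of the two empirical means.
\<close>

definition ghost_weights :: "nat \<Rightarrow> nat \<Rightarrow> real" where
  "ghost_weights n i = (if i < n then 1 / real n else - 1 / real n)"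

text \<open>
  The expectation over the ghost sample of the supremum of the differences of empirical means. It
  bounds the supremum of the deviations from the true mean, and unlike that supremum over a possibly
  uncountable class it is measurable in \<open>S\<close> by Fubini's theorem: only suprema of weighted sums are
  known to be measurable. It therefore takes the place of the supremum throughout.
\<close>

definition ghost_deviation :: "nat \<Rightarrow> (nat \<Rightarrow> 'z) \<Rightarrow> real" where
  "ghost_deviation n S =
     (\<integral>y. weighted_sup (2 * n) (ghost_weights n) (merge {..<n} {n..<2 * n} (S, y))
        \<partial>PiM {n..<2 * n} (\<lambda>_. M))"

lemma sum_lessThan_double: "(\<Sum>i<2 * n. h i) = (\<Sum>i<n. h i) + (\<Sum>i<n. h (n + i))"
  for h :: "nat \<Rightarrow> real"
proof -
  have "{..<2 * n} = {..<n} \<union> {n..<2 * n}" by auto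
  then have "(\<Sum>i<2 * n. h i) = sum h ({..<n} \<union> {n..<2 * n})" by presburger
  also have "\<dots> = sum h {..<n} + sum h {n..<2 * n}"
    by (rule sum.union_disjoint) auto
  also have "sum h {n..<2 * n} = (\<Sum>i<n. h (n + i))"
    by (rule sum.reindex_bij_witness[where i = "\<lambda>i. n + i" and j = "\<lambda>i. i - n"]) auto
  finally show ?thesis .
qed

text \<open>
  For fixed signs, exchange sample point \<open>i\<close> with its ghost wherever \<open>\<sigma> i = -1\<close>. The exchange preserves
  the distribution of the doubled sample and multiplies the \<open>i\<close>-th difference by \<open>\<sigma> i\<close>; the supremum
  of a difference is then at most the sum of one supremum for each half.
\<close>

lemma weighted_sup_symmetrized_le:
  assumes \<sigma>: "\<sigma> \<in> sign_vectors n"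
  shows "(\<integral>z. weighted_sup (2 * n) (ghost_weights n) z \<partial>sample (2 * n))
    \<le> (\<integral>z. weighted_sup n (\<lambda>i. \<sigma> i / real n) z \<partial>sample n)
     + (\<integral>z. weighted_sup n (\<lambda>i. - \<sigma> i / real n) z \<partial>sample n)"
proof -
  define p where "p i = (if i < n then if \<sigma> i = 1 then i else n + i
                         else if \<sigma> (i - n) = 1 then i else i - n)" for i
  let ?w = "ghost_weights n"
  let ?a = "\<lambda>z. weighted_sup n (\<lambda>i. \<sigma> i / real n) (\<lambda>i\<in>{..<n}. z i)"
  let ?b = "\<lambda>z. weighted_sup n (\<lambda>i. - \<sigma> i / real n) (\<lambda>i\<in>{..<n}. z (n + i))"
  interpret S: prob_space "sample (2 * n)" by (rule prob_space_sample)
  have p: "inj_on p {..<2 * n}" "p \<in> {..<2 * n} \<rightarrow> {..<2 * n}"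
    by (auto simp: inj_on_def p_def split: if_splits)
  have pw: "weighted_sup (2 * n) ?w (\<lambda>i\<in>{..<2 * n}. z (p i)) \<le> ?a z + ?b z" for z
  proof (rule weighted_sup_le)
    fix g assume g: "g \<in> G"
    have "(\<Sum>i<2 * n. ?w i * g ((\<lambda>i\<in>{..<2 * n}. z (p i)) i)) =
          (\<Sum>i<n. 1 / real n * g (z (p i))) + (\<Sum>i<n. - 1 / real n * g (z (p (n + i))))"
      unfolding sum_lessThan_double by (simp add: ghost_weights_def)
    also have "\<dots> = (\<Sum>i<n. \<sigma> i / real n * g (z i)) + (\<Sum>i<n. - \<sigma> i / real n * g (z (n + i)))"
      unfolding sum.distrib[symmetric]
    proof (intro sum.cong refl)
      fix i assume "i \<in> {..<n}"
      then show "1 / real n * g (z (p i)) + - 1 / real n * g (z (p (n + i))) =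
                 \<sigma> i / real n * g (z i) + - \<sigma> i / real n * g (z (n + i))"
        using sign_vectorsD[OF \<sigma>, of i] by (auto simp: p_def)
    qed
    also have "\<dots> = (\<Sum>i<n. \<sigma> i / real n * g ((\<lambda>i\<in>{..<n}. z i) i)) +
                     (\<Sum>i<n. - \<sigma> i / real n * g ((\<lambda>i\<in>{..<n}. z (n + i)) i))"
      by simp
    also have "\<dots> \<le> ?a z + ?b z"
      by (intro add_mono weighted_sum_le_sup g)
    finally show "(\<Sum>i<2 * n. ?w i * g ((\<lambda>i\<in>{..<2 * n}. z (p i)) i)) \<le> ?a z + ?b z" .
  qed
  have ia: "integrable (sample (2 * n)) ?a"
  proof (rule S.integrable_const_bound[OF AE_I2])
    show "?a \<in> borel_measurable (sample (2 * n))"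
      by (rule measurable_compose[OF _ measurable_weighted_sup])
         (intro measurable_restrict measurable_component_singleton, auto)
  qed (use abs_weighted_sup_le in auto)
  have ib: "integrable (sample (2 * n)) ?b"
  proof (rule S.integrable_const_bound[OF AE_I2])
    show "?b \<in> borel_measurable (sample (2 * n))"
      by (rule measurable_compose[OF _ measurable_weighted_sup])
         (intro measurable_restrict measurable_component_singleton, auto)
  qed (use abs_weighted_sup_le in auto)
  have ip: "integrable (sample (2 * n)) (\<lambda>z. weighted_sup (2 * n) ?w (\<lambda>i\<in>{..<2 * n}. z (p i)))"
  proof (rule S.integrable_const_bound[OF AE_I2])
    show "(\<lambda>z. weighted_sup (2 * n) ?w (\<lambda>i\<in>{..<2 * n}. z (p i))) \<in> borel_measurable (sample (2 * n))"
      using p(2) by (intro measurable_compose[OF _ measurable_weighted_sup])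
         (intro measurable_restrict measurable_component_singleton, auto)
  qed (use abs_weighted_sup_le in auto)
  have "(\<integral>z. weighted_sup (2 * n) ?w z \<partial>sample (2 * n)) =
        (\<integral>z. weighted_sup (2 * n) ?w (\<lambda>i\<in>{..<2 * n}. z (p i)) \<partial>sample (2 * n))"
    using p by (intro integral_sample_reindex[symmetric]) auto
  also have "\<dots> \<le> (\<integral>z. ?a z + ?b z \<partial>sample (2 * n))"
    using ia ib ip pw by (intro integral_mono) auto
  also have "\<dots> = (\<integral>z. ?a z \<partial>sample (2 * n)) + (\<integral>z. ?b z \<partial>sample (2 * n))"
    using ia ib by simp
  also have "(\<integral>z. ?a z \<partial>sample (2 * n)) = (\<integral>z. weighted_sup n (\<lambda>i. \<sigma> i / real n) z \<partial>sample n)"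
    by (intro integral_sample_reindex) auto
  also have "(\<integral>z. ?b z \<partial>sample (2 * n)) = (\<integral>z. weighted_sup n (\<lambda>i. - \<sigma> i / real n) z \<partial>sample n)"
    by (intro integral_sample_reindex[where f = "\<lambda>i. n + i"]) auto
  finally show ?thesis .
qed

text \<open>
  Averaging over the signs merges the two suprema into twice the same average, as \<open>\<sigma>\<close> and \<open>-\<sigma>\<close> run
  through the same set.
\<close>

lemma symmetrization:
  "(\<integral>z. weighted_sup (2 * n) (ghost_weights n) z \<partial>sample (2 * n))
     \<le> 2 * (\<integral>z. 1 / 2 ^ n * (\<Sum>\<sigma>\<in>sign_vectors n. weighted_sup n (\<lambda>i. \<sigma> i / real n) z) \<partial>sample n)"
proof -
  let ?E = "\<integral>z. weighted_sup (2 * n) (ghost_weights n) z \<partial>sample (2 * n)"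
  define W where "W \<sigma> = (\<integral>z. weighted_sup n (\<lambda>i. \<sigma> i / real n) z \<partial>sample n)" for \<sigma> :: "nat \<Rightarrow> real"
  have "2 ^ n * ?E = (\<Sum>\<sigma>\<in>sign_vectors n. ?E)" by simp
  also have "\<dots> \<le> (\<Sum>\<sigma>\<in>sign_vectors n. W \<sigma> + W (\<lambda>i. - \<sigma> i))"
    unfolding W_def by (intro sum_mono weighted_sup_symmetrized_le)
  also have "\<dots> = 2 * (\<Sum>\<sigma>\<in>sign_vectors n. W \<sigma>)"
    using sum_uminus_sign_vectors[of W n] by (simp add: sum.distrib)
  also have "(\<Sum>\<sigma>\<in>sign_vectors n. W \<sigma>) =
             (\<integral>z. (\<Sum>\<sigma>\<in>sign_vectors n. weighted_sup n (\<lambda>i. \<sigma> i / real n) z) \<partial>sample n)"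
    unfolding W_def
    by (rule Bochner_Integration.integral_sum[symmetric]) (rule integrable_weighted_sup)
  finally show ?thesis by (simp add: field_simps)
qed

lemma measurable_merge_sample:
  "merge {..<n} {n..<2 * n} \<in> sample n \<Otimes>\<^sub>M PiM {n..<2 * n} (\<lambda>_. M) \<rightarrow>\<^sub>M sample (2 * n)"
proof -
  have "{..<n} \<union> {n..<2 * n} = {..<2 * n}" by auto
  then show ?thesis using measurable_merge[of "{..<n}" "{n..<2 * n}" "\<lambda>_. M"] by simp
qed

lemma integrable_merge_section:
  assumes "S \<in> space (sample n)"
  shows "integrable (PiM {n..<2 * n} (\<lambda>_. M))
           (\<lambda>y. weighted_sup (2 * n) w (merge {..<n} {n..<2 * n} (S, y)))"
proof -
  interpret J: prob_space "PiM {n..<2 * n} (\<lambda>_. M)" by (rule prob_space_sample)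
  show ?thesis
  proof (rule J.integrable_const_bound[OF AE_I2])
    show "(\<lambda>y. weighted_sup (2 * n) w (merge {..<n} {n..<2 * n} (S, y)))
            \<in> borel_measurable (PiM {n..<2 * n} (\<lambda>_. M))"
      using measurable_compose[OF measurable_compose[OF measurable_Pair1'[OF assms]
            measurable_merge_sample] measurable_weighted_sup] .
  qed (use abs_weighted_sup_le in auto)
qed

lemma measurable_ghost_deviation [measurable]: "ghost_deviation n \<in> borel_measurable (sample n)"
proof -
  interpret J: prob_space "PiM {n..<2 * n} (\<lambda>_. M)" by (rule prob_space_sample)
  have "(\<lambda>x. weighted_sup (2 * n) (ghost_weights n) (merge {..<n} {n..<2 * n} x))
          \<in> borel_measurable (sample n \<Otimes>\<^sub>M PiM {n..<2 * n} (\<lambda>_. M))"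
    by (rule measurable_compose[OF measurable_merge_sample measurable_weighted_sup])
  then show ?thesis
    unfolding ghost_deviation_def by (intro J.borel_measurable_lebesgue_integral) simp
qed

lemma integral_ghost_deviation:
  "(\<integral>S. ghost_deviation n S \<partial>sample n) =
   (\<integral>z. weighted_sup (2 * n) (ghost_weights n) z \<partial>sample (2 * n))"
proof -
  interpret product_sigma_finite "\<lambda>_. M"
    by (intro product_sigma_finite.intro prob_space_imp_sigma_finite prob_space_axioms)
  have un: "{..<n} \<union> {n..<2 * n} = {..<2 * n}" by auto
  show ?thesis
    unfolding ghost_deviation_def un[symmetric]
    by (intro product_integral_fold[symmetric])
       (auto simp: un intro!: integrable_weighted_sup)
qed

lemma abs_ghost_deviation_le:
  assumes "S \<in> space (sample n)"
  shows "\<bar>ghost_deviation n S\<bar> \<le> (\<Sum>i<2 * n. \<bar>ghost_weights n i\<bar> * (\<bar>a\<bar> + 1))"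
proof -
  interpret J: prob_space "PiM {n..<2 * n} (\<lambda>_. M)" by (rule prob_space_sample)
  have "\<bar>ghost_deviation n S\<bar> \<le>
        (\<integral>y. \<bar>weighted_sup (2 * n) (ghost_weights n) (merge {..<n} {n..<2 * n} (S, y))\<bar>
          \<partial>PiM {n..<2 * n} (\<lambda>_. M))"
    unfolding ghost_deviation_def by (rule integral_abs_bound)
  also have "\<dots> \<le> (\<integral>y. (\<Sum>i<2 * n. \<bar>ghost_weights n i\<bar> * (\<bar>a\<bar> + 1)) \<partial>PiM {n..<2 * n} (\<lambda>_. M))"
    using integrable_merge_section[OF assms]
    by (intro integral_mono abs_weighted_sup_le integrable_abs J.integrable_const)
  finally show ?thesis by (simp add: J.prob_space)
qed

lemma ghost_deviation_update:
  assumes "i < n" "S \<in> space (sample n)" "y \<in> space M"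
  shows "\<bar>ghost_deviation n (S(i := y)) - ghost_deviation n S\<bar> \<le> 1 / real n"
proof -
  interpret J: prob_space "PiM {n..<2 * n} (\<lambda>_. M)" by (rule prob_space_sample)
  let ?h = "\<lambda>S y. weighted_sup (2 * n) (ghost_weights n) (merge {..<n} {n..<2 * n} (S, y))"
  have S': "S(i := y) \<in> space (sample n)"
    using assms by (auto simp: space_PiM PiE_iff extensional_def)
  have "ghost_deviation n (S(i := y)) - ghost_deviation n S =
        (\<integral>x. ?h (S(i := y)) x - ?h S x \<partial>PiM {n..<2 * n} (\<lambda>_. M))"
    unfolding ghost_deviation_def
    by (rule Bochner_Integration.integral_diff[symmetric])
       (rule integrable_merge_section, fact)+
  then have "\<bar>ghost_deviation n (S(i := y)) - ghost_deviation n S\<bar> \<le>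
        (\<integral>x. \<bar>?h (S(i := y)) x - ?h S x\<bar> \<partial>PiM {n..<2 * n} (\<lambda>_. M))"
    by (simp only: integral_abs_bound)
  also have "\<dots> \<le> (\<integral>x. 1 / real n \<partial>PiM {n..<2 * n} (\<lambda>_. M))"
  proof (intro integral_mono)
    fix x
    have "merge {..<n} {n..<2 * n} (S(i := y), x) = (merge {..<n} {n..<2 * n} (S, x))(i := y)"
      using assms(1) by (auto simp: merge_def fun_eq_iff)
    then show "\<bar>?h (S(i := y)) x - ?h S x\<bar> \<le> 1 / real n"
      using abs_weighted_sup_update[of i "2 * n" "ghost_weights n" "merge {..<n} {n..<2 * n} (S, x)" y]
        assms(1) by (simp add: ghost_weights_def)
  qed (use integrable_merge_section[OF S'] integrable_merge_section[OF assms(2)] in auto)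
  finally show ?thesis by (simp add: J.prob_space)
qed

text \<open>
  The integral of a supremum dominates the integral for each single \<open>g\<close>, and the ghost sample has
  mean \<open>\<integral>z. g z \<partial>M\<close>.
\<close>

lemma deviation_le_ghost_deviation:
  assumes g: "g \<in> G" and S: "S \<in> space (sample n)" and n: "n > 0"
  shows "1 / real n * (\<Sum>i<n. g (S i)) - (\<integral>z. g z \<partial>M) \<le> ghost_deviation n S"
proof -
  let ?J = "PiM {n..<2 * n} (\<lambda>_. M)"
  interpret J: prob_space ?J by (rule prob_space_sample)
  have gm: "g \<in> borel_measurable M" using g measurable_class by auto
  have comp: "(\<integral>y. g (y (n + i)) \<partial>?J) = (\<integral>z. g z \<partial>M)" "integrable ?J (\<lambda>y. g (y (n + i)))"
    if "i < n" for i
  proof -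
    have m: "(\<lambda>y. y (n + i)) \<in> ?J \<rightarrow>\<^sub>M M"
      using that by (intro measurable_component_singleton) auto
    have "distr ?J M (\<lambda>y. y (n + i)) = M"
      using that prob_space_axioms by (intro distr_PiM_component) auto
    then show "(\<integral>y. g (y (n + i)) \<partial>?J) = (\<integral>z. g z \<partial>M)"
      using integral_distr[OF m gm] by simp
    show "integrable ?J (\<lambda>y. g (y (n + i)))"
      using measurable_compose[OF m gm] abs_class_le[OF g]
      by (intro J.integrable_const_bound[OF AE_I2]) auto
  qed
  have i2: "integrable ?J (\<lambda>y. \<Sum>i<n. - 1 / real n * g (y (n + i)))"
    using comp(2) by (intro Bochner_Integration.integrable_sum integrable_mult_right) auto
  have "(\<integral>y. (\<Sum>i<n. - 1 / real n * g (y (n + i))) \<partial>?J) = (\<Sum>i<n. - 1 / real n * (\<integral>z. g z \<partial>M))"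
    using comp by (subst Bochner_Integration.integral_sum) auto
  also have "\<dots> = - (\<integral>z. g z \<partial>M)" using n by simp
  finally have "1 / real n * (\<Sum>i<n. g (S i)) - (\<integral>z. g z \<partial>M) =
     (\<integral>y. 1 / real n * (\<Sum>i<n. g (S i)) + (\<Sum>i<n. - 1 / real n * g (y (n + i))) \<partial>?J)"
    using i2 by (subst Bochner_Integration.integral_add) (auto simp: J.prob_space)
  also have "\<dots> \<le> ghost_deviation n S"
    unfolding ghost_deviation_def
  proof (intro integral_mono integrable_merge_section S)
    fix y
    have "1 / real n * (\<Sum>i<n. g (S i)) + (\<Sum>i<n. - 1 / real n * g (y (n + i))) =
          (\<Sum>i<2 * n. ghost_weights n i * g (merge {..<n} {n..<2 * n} (S, y) i))"
      unfolding sum_lessThan_double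
      by (simp add: ghost_weights_def merge_def sum_distrib_left)
    also have "\<dots> \<le> weighted_sup (2 * n) (ghost_weights n) (merge {..<n} {n..<2 * n} (S, y))"
      by (rule weighted_sum_le_sup[OF g])
    finally show "1 / real n * (\<Sum>i<n. g (S i)) + (\<Sum>i<n. - 1 / real n * g (y (n + i))) \<le> \<dots>" .
  qed (use i2 in auto)
  finally show ?thesis .
qed

text \<open>
  McDiarmid's inequality for the ghost deviation, whose coordinate differences are \<open>1 / n\<close> and whose
  mean is bounded by symmetrization. A measurable set \<open>A\<close> is provided because the set of samples on
  which the inequality holds for all \<open>g\<close> need not be measurable itself.
\<close>

theorem uniform_deviation:
  assumes n: "n > 0" and R: "R \<ge> 0"
    and rad: "(\<integral>\<^sup>+S. ennreal (1 / 2 ^ n * (\<Sum>\<sigma>\<in>sign_vectors n. weighted_sup n (\<lambda>i. \<sigma> i / real n) S))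
                 \<partial>sample n) \<le> ennreal R"
    and \<delta>: "0 < \<delta>" "\<delta> < 1"
  obtains A where "A \<in> sets (sample n)" "measure (sample n) A \<ge> 1 - \<delta>"
    "\<And>S g. S \<in> A \<Longrightarrow> g \<in> G \<Longrightarrow>
       1 / real n * (\<Sum>i<n. g (S i)) - (\<integral>z. g z \<partial>M) \<le> 2 * R + sqrt (ln (1 / \<delta>) / (2 * real n))"
proof -
  interpret S: prob_space "sample n" by (rule prob_space_sample)
  define t where "t = sqrt (ln (1 / \<delta>) / (2 * real n))"
  define \<mu> where "\<mu> = (\<integral>S. ghost_deviation n S \<partial>sample n)"
  have t: "t > 0" and t2: "t\<^sup>2 = ln (1 / \<delta>) / (2 * real n)"
    using n \<delta> by (auto simp: t_def)
  have \<mu>: "\<mu> \<le> 2 * R"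
    unfolding \<mu>_def integral_ghost_deviation
    using symmetrization[of n] integral_real_bounded[OF R rad] by linarith
  have c: "(\<Sum>i<n. (1 / real n)\<^sup>2) = 1 / real n"
    using n by (simp add: power2_eq_square)
  have "S.prob {S \<in> space (sample n). ghost_deviation n S \<ge> \<mu> + t}
          \<le> exp (- 2 * t\<^sup>2 / (\<Sum>i<n. (1 / real n)\<^sup>2))"
    unfolding \<mu>_def
  proof (rule bounded_differences_tail)
    show "\<bar>ghost_deviation n x\<bar> \<le> (\<Sum>i<2 * n. \<bar>ghost_weights n i\<bar> * (\<bar>a\<bar> + 1))"
      if "x \<in> space (sample n)" for x
      using abs_ghost_deviation_le[OF that] .
    show "\<bar>ghost_deviation n (x(i := y)) - ghost_deviation n x\<bar> \<le> 1 / real n"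
      if "i \<in> {..<n}" "x \<in> space (sample n)" "y \<in> space M" for i x y
      using ghost_deviation_update that by auto
  qed (use t n c prob_space_axioms in auto)
  also have "\<dots> = \<delta>"
    unfolding c t2 using n \<delta> by (simp add: exp_minus ln_div)
  finally have tail: "S.prob {S \<in> space (sample n). ghost_deviation n S \<ge> \<mu> + t} \<le> \<delta>" .
  define A where "A = {S \<in> space (sample n). \<not> ghost_deviation n S \<ge> \<mu> + t}"
  have A: "A \<in> sets (sample n)" unfolding A_def by measurable
  have "S.prob A = 1 - S.prob {S \<in> space (sample n). ghost_deviation n S \<ge> \<mu> + t}"
    unfolding A_def by (rule S.prob_neg) measurable
  then have "S.prob A \<ge> 1 - \<delta>" using tail by simp
  moreover have "1 / real n * (\<Sum>i<n. g (S i)) - (\<integral>z. g z \<partial>M) \<le> 2 * R + t"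
    if "S \<in> A" "g \<in> G" for S g
    using deviation_le_ghost_deviation[OF that(2) _ n, of S] that(1) \<mu> by (simp add: A_def)
  ultimately show ?thesis using A that unfolding t_def by blast
qed

end

section \<open>Rademacher averages of predictor classes\<close>

lemma emp_rademacher_eq_sum:
  "emp_rademacher n G z = ennreal (1 / 2 ^ n) *
     (\<Sum>\<sigma>\<in>sign_vectors n. ennreal (1 / real n) * (SUP g\<in>G. ennreal \<bar>\<Sum>i<n. \<sigma> i * g (z i)\<bar>))"
proof -
  have "Pi_pmf {..<n} 0 (\<lambda>_. pmf_of_set {-1, 1 :: real}) = pmf_of_set (sign_vectors n)"
    unfolding sign_vectors_def by (rule Pi_pmf_of_set) auto
  then have "emp_rademacher n G z =
    (\<Sum>\<sigma>\<in>sign_vectors n. ennreal (1 / real n) * (SUP g\<in>G. ennreal \<bar>\<Sum>i<n. \<sigma> i * g (z i)\<bar>)) / 2 ^ n"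
    unfolding emp_rademacher_def
    by (simp add: nn_integral_pmf_of_set ennreal_of_nat_eq_real_of_nat flip: ennreal_power)
  also have "\<dots> = ennreal (1 / 2 ^ n) *
    (\<Sum>\<sigma>\<in>sign_vectors n. ennreal (1 / real n) * (SUP g\<in>G. ennreal \<bar>\<Sum>i<n. \<sigma> i * g (z i)\<bar>))"
  proof -
    have "ennreal (1 / 2 ^ n) = inverse (ennreal (2 ^ n))"
      by (subst inverse_ennreal) (auto simp: inverse_eq_divide)
    also have "ennreal (2 ^ n) = 2 ^ n" by (simp flip: ennreal_power)
    finally show ?thesis by (simp add: divide_ennreal_def mult.commute)
  qed
  finally show ?thesis .
qed

text \<open>
  The measurability hypothesis speaks of signed suprema in the extended reals, the Rademacher average
  of absolute values in the extended nonnegative reals; this identity translates between the two.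
\<close>

lemma SUP_ennreal_abs:
  fixes s :: "'b \<Rightarrow> real"
  shows "(SUP g\<in>G. ennreal \<bar>s g\<bar>) =
         max (e2ennreal (SUP g\<in>G. ereal (s g))) (e2ennreal (SUP g\<in>G. ereal (- s g)))"
proof (rule antisym)
  show "(SUP g\<in>G. ennreal \<bar>s g\<bar>) \<le>
         max (e2ennreal (SUP g\<in>G. ereal (s g))) (e2ennreal (SUP g\<in>G. ereal (- s g)))"
  proof (rule SUP_least)
    fix g assume g: "g \<in> G"
    have "e2ennreal (ereal (s g)) \<le> e2ennreal (SUP g\<in>G. ereal (s g))"
      "e2ennreal (ereal (- s g)) \<le> e2ennreal (SUP g\<in>G. ereal (- s g))"
      by (rule e2ennreal_mono, rule SUP_upper, rule g)+
    then show "ennreal \<bar>s g\<bar> \<le>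
         max (e2ennreal (SUP g\<in>G. ereal (s g))) (e2ennreal (SUP g\<in>G. ereal (- s g)))"
      by (cases "s g \<ge> 0") (simp_all add: le_max_iff_disj e2ennreal_ereal)
  qed
  let ?T = "SUP g\<in>G. ennreal \<bar>s g\<bar>"
  have T: "ereal \<bar>s g\<bar> \<le> enn2ereal ?T" if "g \<in> G" for g
  proof -
    have "enn2ereal (ennreal \<bar>s g\<bar>) \<le> enn2ereal ?T"
      using SUP_upper[OF that, of "\<lambda>g. ennreal \<bar>s g\<bar>"] by (simp only: less_eq_ennreal.rep_eq)
    then show ?thesis by simp
  qed
  have "e2ennreal (SUP g\<in>G. ereal (s g)) \<le> e2ennreal (enn2ereal ?T)"
    using T by (intro e2ennreal_mono SUP_least) (meson abs_ge_self ereal_less_eq(3) order_trans)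
  moreover have "e2ennreal (SUP g\<in>G. ereal (- s g)) \<le> e2ennreal (enn2ereal ?T)"
    using T by (intro e2ennreal_mono SUP_least) (meson abs_ge_minus_self ereal_less_eq(3) order_trans)
  ultimately show "max (e2ennreal (SUP g\<in>G. ereal (s g))) (e2ennreal (SUP g\<in>G. ereal (- s g))) \<le> ?T"
    by simp
qed

lemma measurable_emp_rademacher:
  assumes "measurable_suprema M G"
  shows "emp_rademacher n G \<in> borel_measurable (PiM {..<n} (\<lambda>_. M))"
proof -
  have m: "(\<lambda>z. SUP g\<in>G. ereal (\<Sum>i<n. w i * g (z i))) \<in> borel_measurable (PiM {..<n} (\<lambda>_. M))" for w
    using assms unfolding measurable_suprema_def by blast
  have m': "(\<lambda>z. SUP g\<in>G. ereal (- (\<Sum>i<n. w i * g (z i)))) \<in> borel_measurable (PiM {..<n} (\<lambda>_. M))" for w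
    using m[of "\<lambda>i. - w i"] by (simp add: sum_negf)
  show ?thesis
    unfolding emp_rademacher_eq_sum[abs_def] SUP_ennreal_abs
    by (intro borel_measurable_times_ennreal borel_measurable_sum borel_measurable_const
          borel_measurable_max measurable_compose[OF m measurable_e2ennreal]
          measurable_compose[OF m' measurable_e2ennreal])
qed

lemma measurable_emp_rademacher_distr:
  assumes "measurable_suprema (distr P N h) G"
  shows "emp_rademacher n G \<in> borel_measurable (PiM {..<n} (\<lambda>_. N))"
proof -
  have "sets (PiM {..<n} (\<lambda>_. distr P N h)) = sets (PiM {..<n} (\<lambda>_. N))"
    by (auto intro!: sets_PiM_cong)
  then show ?thesis
    using measurable_emp_rademacher[OF assms, of n] measurable_cong_sets by blast
qed

lemma rademacher_distr:
  assumes P: "prob_space P" and h: "h \<in> P \<rightarrow>\<^sub>M N" and sup: "measurable_suprema (distr P N h) G"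
  shows "rademacher (distr P N h) n G =
         (\<integral>\<^sup>+S. emp_rademacher n G (\<lambda>i. h (S i)) \<partial>PiM {..<n} (\<lambda>_. P))"
proof -
  have d: "distr (PiM {..<n} (\<lambda>_. P)) (PiM {..<n} (\<lambda>_. N)) (compose {..<n} h) =
           PiM {..<n} (\<lambda>_. distr P N h)"
  proof -
    have "distr (PiM {..<n} (\<lambda>_. P)) (PiM {..<n} (\<lambda>_. distr P N h)) (compose {..<n} h) =
           PiM {..<n} (\<lambda>_. distr P (distr P N h) h)"
      using P h prob_space.prob_space_distr[OF P h]
      by (intro distr_PiM_finite_prob_space') auto
    moreover have "distr P (distr P N h) h = distr P N h"
      by (rule distr_cong) auto
    moreover have "distr (PiM {..<n} (\<lambda>_. P)) (PiM {..<n} (\<lambda>_. distr P N h)) (compose {..<n} h) =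
                   distr (PiM {..<n} (\<lambda>_. P)) (PiM {..<n} (\<lambda>_. N)) (compose {..<n} h)"
      by (rule distr_cong) (auto intro!: sets_PiM_cong)
    ultimately show ?thesis by simp
  qed
  have m: "compose {..<n} h \<in> PiM {..<n} (\<lambda>_. P) \<rightarrow>\<^sub>M PiM {..<n} (\<lambda>_. N)"
    unfolding compose_def
    by (intro measurable_restrict measurable_compose[OF measurable_component_singleton]) (auto intro: h)
  have "rademacher (distr P N h) n G =
        (\<integral>\<^sup>+S. emp_rademacher n G (compose {..<n} h S) \<partial>PiM {..<n} (\<lambda>_. P))"
    unfolding rademacher_def d[symmetric] by (rule nn_integral_distr[OF m]) (use measurable_emp_rademacher_distr[OF sup] in simp)
  also have "(\<lambda>S. emp_rademacher n G (compose {..<n} h S)) = (\<lambda>S. emp_rademacher n G (\<lambda>i. h (S i)))"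
    unfolding emp_rademacher_eq_sum by (simp add: compose_def)
  finally show ?thesis .
qed

text \<open>
  Uniform deviation for losses \<open>\<psi> z (\<beta> (h z))\<close> that are Lipschitz in the prediction: contraction
  bounds the Rademacher average of the losses on each sample by \<open>L\<close> times that of the predictors
  on the sample of features \<open>h (S i)\<close>.
\<close>

lemma uniform_deviation_lipschitz:
  fixes P :: "'z measure" and \<psi> :: "'z \<Rightarrow> real \<Rightarrow> real" and B :: "('x \<Rightarrow> real) set"
    and h :: "'z \<Rightarrow> 'x"
  defines "loss \<equiv> \<lambda>\<beta> z. \<psi> z (\<beta> (h z))"
  assumes P: "prob_space P" and h: "h \<in> P \<rightarrow>\<^sub>M N" and n: "n > 0" and B: "B \<noteq> {}"
    and range: "\<And>z s. \<psi> z s \<in> {a..a + 1}"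
    and L: "L \<ge> 0" and lip: "\<And>z s t. \<bar>\<psi> z s - \<psi> z t\<bar> \<le> L * \<bar>s - t\<bar>"
    and meas: "\<And>\<beta>. \<beta> \<in> B \<Longrightarrow> loss \<beta> \<in> borel_measurable P"
    and sup: "measurable_suprema P (loss ` B)" "measurable_suprema (distr P N h) B"
    and R: "rademacher (distr P N h) n B = ennreal R" "R \<ge> 0"
    and \<delta>: "0 < \<delta>" "\<delta> < 1"
  obtains A where "A \<in> sets (PiM {..<n} (\<lambda>_. P))" "measure (PiM {..<n} (\<lambda>_. P)) A \<ge> 1 - \<delta>"
    "\<And>S \<beta>. S \<in> A \<Longrightarrow> \<beta> \<in> B \<Longrightarrow>
       1 / real n * (\<Sum>i<n. loss \<beta> (S i)) - (\<integral>z. loss \<beta> z \<partial>P)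
         \<le> 2 * L * R + sqrt (ln (1 / \<delta>) / (2 * real n))"
proof -
  interpret P: prob_space P by (rule P)
  interpret bounded_function_class P "loss ` B" a
    by unfold_locales (use B meas range sup in \<open>auto simp: loss_def\<close>)
  have pointwise: "ennreal (1 / 2 ^ n * (\<Sum>\<sigma>\<in>sign_vectors n. weighted_sup n (\<lambda>i. \<sigma> i / real n) S))
      \<le> ennreal L * emp_rademacher n B (\<lambda>i. h (S i))" for S
  proof -
    have scale: "(SUP \<beta>\<in>B. ennreal \<bar>\<Sum>i<n. \<sigma> i * (\<beta> (h (S i)) / real n)\<bar>) =
        ennreal (1 / real n) * (SUP \<beta>\<in>B. ennreal \<bar>\<Sum>i<n. \<sigma> i * \<beta> (h (S i))\<bar>)" for \<sigma> :: "nat \<Rightarrow> real"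
    proof -
      have "ennreal \<bar>\<Sum>i<n. \<sigma> i * (\<beta> (h (S i)) / real n)\<bar> =
            ennreal (1 / real n) * ennreal \<bar>\<Sum>i<n. \<sigma> i * \<beta> (h (S i))\<bar>" for \<beta>
        by (simp add: ennreal_mult[symmetric] sum_divide_distrib[symmetric] abs_divide)
      then show ?thesis by (simp add: SUP_mult_left_ennreal)
    qed
    have "ennreal (\<Sum>\<sigma>\<in>sign_vectors n. weighted_sup n (\<lambda>i. \<sigma> i / real n) S) =
          ennreal (\<Sum>\<sigma>\<in>sign_vectors n. SUP \<beta>\<in>B. \<Sum>i<n. \<sigma> i * (loss \<beta> (S i) / real n))"
      by (simp add: weighted_sup_def image_image)
    also have "\<dots> \<le> ennreal L *
        (\<Sum>\<sigma>\<in>sign_vectors n. SUP \<beta>\<in>B. ennreal \<bar>\<Sum>i<n. \<sigma> i * (\<beta> (h (S i)) / real n)\<bar>)"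
    proof (rule rademacher_contraction[OF B L])
      fix i \<beta> assume "\<beta> \<in> B"
      then have "\<bar>loss \<beta> (S i)\<bar> \<le> \<bar>a\<bar> + 1" by (intro abs_class_le) auto
      then show "\<bar>loss \<beta> (S i) / real n\<bar> \<le> (\<bar>a\<bar> + 1) / real n"
        by (simp add: divide_right_mono)
    next
      fix i \<beta> \<beta>'
      have "\<bar>loss \<beta> (S i) / real n - loss \<beta>' (S i) / real n\<bar> =
            \<bar>loss \<beta> (S i) - loss \<beta>' (S i)\<bar> / real n"
        by (simp flip: diff_divide_distrib)
      also have "\<dots> \<le> L * \<bar>\<beta> (h (S i)) - \<beta>' (h (S i))\<bar> / real n"
        unfolding loss_def by (intro divide_right_mono lip) auto
      also have "\<dots> = L * \<bar>\<beta> (h (S i)) / real n - \<beta>' (h (S i)) / real n\<bar>"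
        by (simp flip: diff_divide_distrib)
      finally show "\<bar>loss \<beta> (S i) / real n - loss \<beta>' (S i) / real n\<bar> \<le> \<dots>" .
    qed
    also have "\<dots> = ennreal L * (\<Sum>\<sigma>\<in>sign_vectors n.
        ennreal (1 / real n) * (SUP \<beta>\<in>B. ennreal \<bar>\<Sum>i<n. \<sigma> i * \<beta> (h (S i))\<bar>))"
      by (simp only: scale)
    finally have "ennreal (1 / 2 ^ n) * ennreal (\<Sum>\<sigma>\<in>sign_vectors n. weighted_sup n (\<lambda>i. \<sigma> i / real n) S)
      \<le> ennreal (1 / 2 ^ n) * (ennreal L * (\<Sum>\<sigma>\<in>sign_vectors n.
          ennreal (1 / real n) * (SUP \<beta>\<in>B. ennreal \<bar>\<Sum>i<n. \<sigma> i * \<beta> (h (S i))\<bar>)))"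
      by (rule mult_left_mono) simp
    then show ?thesis
      unfolding emp_rademacher_eq_sum
      by (subst ennreal_mult') (simp_all only: mult.left_commute zero_le_divide_1_iff zero_le_power
            zero_le_numeral)
  qed
  have me: "(\<lambda>S. emp_rademacher n B (\<lambda>i. h (S i))) \<in> borel_measurable (PiM {..<n} (\<lambda>_. P))"
  proof -
    have h_sample: "(\<lambda>S. \<lambda>i\<in>{..<n}. h (S i)) \<in> PiM {..<n} (\<lambda>_. P) \<rightarrow>\<^sub>M PiM {..<n} (\<lambda>_. N)"
      by (intro measurable_restrict measurable_compose[OF measurable_component_singleton]) (auto intro: h)
    have "emp_rademacher n B (\<lambda>i\<in>{..<n}. h (S i)) = emp_rademacher n B (\<lambda>i. h (S i))" for S
      unfolding emp_rademacher_eq_sum by simp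
    then show ?thesis using measurable_compose[OF h_sample measurable_emp_rademacher_distr[OF sup(2)]] by simp
  qed
  have "(\<integral>\<^sup>+S. ennreal (1 / 2 ^ n * (\<Sum>\<sigma>\<in>sign_vectors n. weighted_sup n (\<lambda>i. \<sigma> i / real n) S))
          \<partial>sample n) \<le> (\<integral>\<^sup>+S. ennreal L * emp_rademacher n B (\<lambda>i. h (S i)) \<partial>sample n)"
    by (intro nn_integral_mono pointwise)
  also have "\<dots> = ennreal L * rademacher (distr P N h) n B"
    unfolding rademacher_distr[OF P h sup(2)] by (rule nn_integral_cmult[OF me])
  also have "\<dots> = ennreal (L * R)" using R L by (simp add: ennreal_mult)
  finally have rad: "(\<integral>\<^sup>+S. ennreal (1 / 2 ^ n * (\<Sum>\<sigma>\<in>sign_vectors n. weighted_sup n (\<lambda>i. \<sigma> i / real n) S))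
          \<partial>sample n) \<le> ennreal (L * R)" .
  show ?thesis
  proof (rule uniform_deviation[OF n _ rad \<delta>])
    show "L * R \<ge> 0" using L R by simp
    fix A assume A: "A \<in> sets (sample n)" "measure (sample n) A \<ge> 1 - \<delta>"
      "\<And>S g. S \<in> A \<Longrightarrow> g \<in> loss ` B \<Longrightarrow>
       1 / real n * (\<Sum>i<n. g (S i)) - (\<integral>z. g z \<partial>P) \<le> 2 * (L * R) + sqrt (ln (1 / \<delta>) / (2 * real n))"
    show thesis
      by (rule that[OF A(1,2)]) (use A(3) in \<open>auto simp: mult.assoc\<close>)
  qed
qed

lemma measurable_suprema_uminus:
  assumes "measurable_suprema M G"
  shows "measurable_suprema M ((\<lambda>g z. - g z) ` G)"
  unfolding measurable_suprema_def
proof (intro allI)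
  fix N and w :: "nat \<Rightarrow> real"
  have "(\<lambda>z. SUP g\<in>G. ereal (\<Sum>i<N. - w i * g (z i))) \<in> borel_measurable (PiM {..<N} (\<lambda>_. M))"
    using assms unfolding measurable_suprema_def by (elim allE[of _ N] allE[of _ "\<lambda>i. - w i"])
  then show "(\<lambda>z. SUP g\<in>(\<lambda>g z. - g z) ` G. ereal (\<Sum>i<N. w i * g (z i)))
               \<in> borel_measurable (PiM {..<N} (\<lambda>_. M))"
    by (simp add: image_image)
qed

section \<open>Ramp functions and coverage of a band\<close>

lemma ramp_lipschitz:
  assumes "\<epsilon> > 0"
  shows "\<bar>ramp_minus \<epsilon> s - ramp_minus \<epsilon> t\<bar> \<le> 1 / \<epsilon> * \<bar>s - t\<bar>"
    and "\<bar>ramp_plus \<epsilon> s - ramp_plus \<epsilon> t\<bar> \<le> 1 / \<epsilon> * \<bar>s - t\<bar>"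
proof -
  have "1 / \<epsilon> * \<bar>s - t\<bar> = \<bar>s / \<epsilon> - t / \<epsilon>\<bar>"
    using assms by (simp flip: diff_divide_distrib)
  then show "\<bar>ramp_minus \<epsilon> s - ramp_minus \<epsilon> t\<bar> \<le> 1 / \<epsilon> * \<bar>s - t\<bar>"
    and "\<bar>ramp_plus \<epsilon> s - ramp_plus \<epsilon> t\<bar> \<le> 1 / \<epsilon> * \<bar>s - t\<bar>"
    unfolding ramp_minus_def ramp_plus_def by (auto simp: min_def max_def abs_if)
qed

lemma ramp_range: "ramp_minus \<epsilon> z \<in> {0..1}" "ramp_plus \<epsilon> z \<in> {0..1}"
  by (auto simp: ramp_minus_def ramp_plus_def)

lemma measurable_ramp [measurable]:
  "ramp_minus \<epsilon> \<in> borel_measurable borel" "ramp_plus \<epsilon> \<in> borel_measurable borel"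
  unfolding ramp_minus_def[abs_def] ramp_plus_def[abs_def] by measurable

text \<open>
  The ramps are continuous surrogates on the safe sides: \<open>ramp_minus \<epsilon> (y - u)\<close> is at most the indicator
  of \<open>y < u\<close>, and \<open>ramp_plus \<epsilon> (y - l)\<close> is at least the indicator of \<open>y \<le> l\<close>.
\<close>

lemma band_indicator_ge_ramps:
  assumes "\<epsilon> > 0"
  shows "ramp_minus \<epsilon> (y - u) - ramp_plus \<epsilon> (y - l) \<le> (if l \<le> y \<and> y \<le> u then 1 else 0)"
proof -
  have "ramp_minus \<epsilon> (y - u) = 0" if "y \<ge> u"
    using that assms by (simp add: ramp_minus_def)
  moreover have "ramp_plus \<epsilon> (y - l) = 1" if "y \<le> l"
    using that assms by (simp add: ramp_plus_def divide_le_0_iff)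
  ultimately show ?thesis
    using ramp_range(1)[of \<epsilon> "y - u"] ramp_range(2)[of \<epsilon> "y - l"] by auto
qed

lemma prob_band_ge_ramps:
  assumes P: "prob_space P" and \<epsilon>: "\<epsilon> > 0"
    and [measurable]: "y \<in> borel_measurable P" "l \<in> borel_measurable P" "u \<in> borel_measurable P"
  shows "(\<integral>z. ramp_minus \<epsilon> (y z - u z) \<partial>P) - (\<integral>z. ramp_plus \<epsilon> (y z - l z) \<partial>P)
           \<le> measure P {z \<in> space P. l z \<le> y z \<and> y z \<le> u z}"
proof -
  interpret prob_space P by (rule P)
  have i: "integrable P (\<lambda>z. ramp_minus \<epsilon> (y z - u z))" "integrable P (\<lambda>z. ramp_plus \<epsilon> (y z - l z))"
    using ramp_range by (auto intro!: integrable_const_bound[of _ 1])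
  have "(\<integral>z. ramp_minus \<epsilon> (y z - u z) \<partial>P) - (\<integral>z. ramp_plus \<epsilon> (y z - l z) \<partial>P) =
        (\<integral>z. ramp_minus \<epsilon> (y z - u z) - ramp_plus \<epsilon> (y z - l z) \<partial>P)"
    using i by simp
  also have "\<dots> \<le> (\<integral>z. indicator {z \<in> space P. l z \<le> y z \<and> y z \<le> u z} z \<partial>P)"
  proof (intro integral_mono)
    show "integrable P (indicator {z \<in> space P. l z \<le> y z \<and> y z \<le> u z} :: _ \<Rightarrow> real)"
      by (intro integrable_real_indicator) (auto simp: emeasure_eq_measure)
    show "ramp_minus \<epsilon> (y z - u z) - ramp_plus \<epsilon> (y z - l z) \<le>
            indicator {z \<in> space P. l z \<le> y z \<and> y z \<le> u z} z" if "z \<in> space P" for z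
      using band_indicator_ge_ramps[OF \<epsilon>, of "y z" "u z" "l z"] that by (auto simp: indicator_def)
  qed (use i in auto)
  also have "\<dots> = measure P {z \<in> space P. l z \<le> y z \<and> y z \<le> u z}"
    by simp
  finally show ?thesis .
qed

lemma prob_product_event_ge:
  fixes E :: "('m::finite \<Rightarrow> 'a) set"
  assumes P: "prob_space P" and A: "A \<in> sets P"
    and E: "E \<in> sets (PiM UNIV (\<lambda>_. P))" "(\<Pi>\<^sub>E j\<in>UNIV. A) \<subseteq> E"
  shows "measure P A ^ CARD('m) \<le> measure (PiM (UNIV :: 'm set) (\<lambda>_. P)) E"
proof -
  interpret prob_space P by (rule P)
  interpret Pm: finite_product_prob_space "\<lambda>_. P" "UNIV :: 'm set"
    by (intro finite_product_prob_space.intro finite_product_sigma_finite.intro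
        finite_product_sigma_finite_axioms.intro product_prob_spaceI product_sigma_finite.intro
        prob_space_imp_sigma_finite P finite)
  have "measure P A ^ CARD('m) = Pm.prob (\<Pi>\<^sub>E j\<in>(UNIV :: 'm set). A)"
    using A by (subst Pm.prob_times) auto
  also have "\<dots> \<le> Pm.prob E"
    by (rule Pm.finite_measure_mono[OF E(2,1)])
  finally show ?thesis .
qed

section \<open>Feasibility of the robust solution\<close>

theorem theorem5p1:
  fixes X :: "(real ^ 'd) set" and Y :: "real set"
    and P :: "((real ^ 'd) \<times> real) measure"
    and n :: nat
    and B\<^sub>0 :: "((real ^ 'd) \<Rightarrow> real) set"
    and \<delta>\<^sub>p \<delta>\<^sub>q :: real
    and \<beta>Alg :: "real \<Rightarrow> (nat \<Rightarrow> (real ^ 'd) \<times> real) \<Rightarrow> (real ^ 'd) \<Rightarrow> real"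
    and D :: "(real ^ 'd1) set" and K :: "(real ^ 'd2) set"
    and f :: "real ^ 'd1 \<Rightarrow> real ^ 'm \<Rightarrow> real"
    and F :: "real ^ 'd1 \<Rightarrow> real ^ 'm \<Rightarrow> real ^ 'd2"
    and \<pi>star :: "(real ^ 'm) set \<Rightarrow> real ^ 'd1"
    and \<epsilon> \<delta> :: real
  defines "PX \<equiv> distr P (restrict_space borel X) fst"
    and "Train \<equiv> PiM {..<n} (\<lambda>_. P)"
    and "Test \<equiv> PiM (UNIV :: 'm set) (\<lambda>_. P)"
    and "U \<equiv> \<lambda>S x. uncertainty_box (\<beta>Alg \<delta>\<^sub>p S) (\<beta>Alg \<delta>\<^sub>q S) x"
  assumes "prob_space P" and "sets P = sets (restrict_space borel (X \<times> Y))"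
    and "n \<ge> 1"
    and "0 \<le> \<delta>\<^sub>p" "\<delta>\<^sub>p \<le> \<delta>\<^sub>q" "\<delta>\<^sub>q \<le> 1"
    and "\<epsilon> > 0"
    and "convex_cone K"
    and alg: "\<And>\<tau> S. \<tau> \<in> {\<delta>\<^sub>p, \<delta>\<^sub>q} \<Longrightarrow> S \<in> space Train \<Longrightarrow>
           is_arg_min (empirical_risk \<tau> n S) (\<lambda>\<beta>. \<beta> \<in> B\<^sub>0) (\<beta>Alg \<tau> S)"
    and opt: "\<And>S x. S \<in> space Train \<Longrightarrow> (\<forall>j. x j \<in> X) \<Longrightarrow>
           robust_optimal D f F K (U S x) (\<pi>star (U S x))"
    and meas_B: "B\<^sub>0 \<subseteq> borel_measurable (restrict_space borel X)"
    and meas_sup: "measurable_suprema PX B\<^sub>0"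
      "measurable_suprema P {\<lambda>(x, y). ramp_minus \<epsilon> (y - \<beta> x) |\<beta>. \<beta> \<in> B\<^sub>0}"
      "measurable_suprema P {\<lambda>(x, y). ramp_plus \<epsilon> (y - \<beta> x) |\<beta>. \<beta> \<in> B\<^sub>0}"
    and meas_alg: "\<And>\<tau>. \<tau> \<in> {\<delta>\<^sub>p, \<delta>\<^sub>q} \<Longrightarrow>
           (\<lambda>(S, x). \<beta>Alg \<tau> S x) \<in> borel_measurable (Train \<Otimes>\<^sub>M restrict_space borel X)"
    and meas_event: "{(S, T) \<in> space (Train \<Otimes>\<^sub>M Test).
             F (\<pi>star (U S (\<lambda>j. fst (T j)))) (\<chi> j. snd (T j)) \<in> K} \<in> sets (Train \<Otimes>\<^sub>M Test)"
    and "0 < \<delta>" "\<delta> < 1"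
  shows "measure Train {S \<in> space Train.
           ereal (measure Test {T \<in> space Test.
                    F (\<pi>star (U S (\<lambda>j. fst (T j)))) (\<chi> j. snd (T j)) \<in> K})
           \<ge> (max 0
                (ereal (1 / real n * (\<Sum>i<n.
                      ramp_minus \<epsilon> (snd (S i) - \<beta>Alg \<delta>\<^sub>q S (fst (S i)))
                    - ramp_plus \<epsilon> (snd (S i) - \<beta>Alg \<delta>\<^sub>p S (fst (S i)))))
                 - ereal (8 / \<epsilon>) * enn2ereal (rademacher PX n B\<^sub>0)
                 - ereal (2 * sqrt (ln (2 / \<delta>) / (2 * real n))))) ^ CARD('m)}
         \<ge> 1 - \<delta>"
proof -
  interpret P: prob_space P by fact
  interpret Train: prob_space Train unfolding Train_def by (intro prob_space_PiM \<open>prob_space P\<close>)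
  interpret Test: prob_space Test unfolding Test_def by (intro prob_space_PiM \<open>prob_space P\<close>)
  define Q where "Q = {(S, T) \<in> space (Train \<Otimes>\<^sub>M Test).
             F (\<pi>star (U S (\<lambda>j. fst (T j)))) (\<chi> j. snd (T j)) \<in> K}"
  define E where "E S = {T \<in> space Test. F (\<pi>star (U S (\<lambda>j. fst (T j)))) (\<chi> j. snd (T j)) \<in> K}" for S
  define emp where "emp S = 1 / real n * (\<Sum>i<n.
                      ramp_minus \<epsilon> (snd (S i) - \<beta>Alg \<delta>\<^sub>q S (fst (S i)))
                    - ramp_plus \<epsilon> (snd (S i) - \<beta>Alg \<delta>\<^sub>p S (fst (S i))))" for S
  define t where "t = sqrt (ln (2 / \<delta>) / (2 * real n))"
  have n: "n > 0" using \<open>n \<ge> 1\<close> by simp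
  have sets_P: "sets P = sets (restrict_space borel (X \<times> Y))" by fact
  have space_P: "space P = X \<times> Y"
    using sets_eq_imp_space_eq[OF sets_P] by (simp add: space_restrict_space)
  have fst_P: "fst \<in> P \<rightarrow>\<^sub>M restrict_space borel X"
  proof -
    have "fst \<in> restrict_space (borel :: ((real ^ 'd) \<times> real) measure) (X \<times> Y) \<rightarrow>\<^sub>M restrict_space borel X"
      by (intro measurable_restrict_space3 borel_measurable_continuous_onI continuous_on_fst
            continuous_on_id) auto
    then show ?thesis using measurable_cong_sets[OF sets_P refl] by blast
  qed
  have snd_P[measurable]: "snd \<in> borel_measurable P"
  proof -
    have "snd \<in> borel_measurable (restrict_space (borel :: ((real ^ 'd) \<times> real) measure) (X \<times> Y))"
      by (intro measurable_restrict_space1 borel_measurable_continuous_onI continuous_on_snd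
            continuous_on_id)
    then show ?thesis using measurable_cong_sets[OF sets_P refl] by blast
  qed
  have B_P[measurable]: "(\<lambda>z. \<beta> (fst z)) \<in> borel_measurable P" if "\<beta> \<in> B\<^sub>0" for \<beta>
    using measurable_compose[OF fst_P, of \<beta> borel] meas_B that by auto
  have Alg: "\<beta>Alg \<tau> S \<in> B\<^sub>0" if "\<tau> \<in> {\<delta>\<^sub>p, \<delta>\<^sub>q}" "S \<in> space Train" for \<tau> S
    using alg[OF that] by (simp add: is_arg_min_def)
  have B_nonempty: "B\<^sub>0 \<noteq> {}"
    using Alg[of \<delta>\<^sub>p] Train.not_empty by auto

  have Q: "Q \<in> sets (Train \<Otimes>\<^sub>M Test)" unfolding Q_def by (rule meas_event)
  have E_Q: "E S = Pair S -` Q" if "S \<in> space Train" for S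
    using that by (auto simp: E_def Q_def space_pair_measure)
  have E_sets: "E S \<in> sets Test" if "S \<in> space Train" for S
    unfolding E_Q[OF that] by (rule sets_Pair1[OF Q])
  have E_meas: "(\<lambda>S. measure Test (E S)) \<in> borel_measurable Train"
  proof -
    have "(\<lambda>S. enn2real (emeasure Test (Pair S -` Q))) \<in> borel_measurable Train"
      by (intro borel_measurable_enn2real Test.measurable_emeasure_Pair[OF Q])
    then show ?thesis
      by (rule measurable_cong[THEN iffD1, rotated]) (simp add: E_Q measure_def)
  qed
  have component: "(\<lambda>S. S i) \<in> Train \<rightarrow>\<^sub>M P" if "i < n" for i
    unfolding Train_def using that by (intro measurable_component_singleton) auto
  have Alg_meas: "(\<lambda>S. \<beta>Alg \<tau> S (fst (S i))) \<in> borel_measurable Train"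
    if "\<tau> \<in> {\<delta>\<^sub>p, \<delta>\<^sub>q}" "i < n" for \<tau> i
  proof -
    have "(\<lambda>S. (S, fst (S i))) \<in> Train \<rightarrow>\<^sub>M Train \<Otimes>\<^sub>M restrict_space borel X"
      by (intro measurable_Pair measurable_ident_sets refl
            measurable_compose[OF component[OF that(2)] fst_P])
    from measurable_compose[OF this meas_alg[OF that(1)]] show ?thesis by simp
  qed
  have emp_meas: "emp \<in> borel_measurable Train"
  proof -
    have "(\<lambda>S. ramp_minus \<epsilon> (snd (S i) - \<beta>Alg \<delta>\<^sub>q S (fst (S i)))
             - ramp_plus \<epsilon> (snd (S i) - \<beta>Alg \<delta>\<^sub>p S (fst (S i)))) \<in> borel_measurable Train"
      if "i < n" for i
    proof -
      have [measurable]: "(\<lambda>S. snd (S i)) \<in> borel_measurable Train"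
        by (rule measurable_compose[OF component[OF that] snd_P])
      have [measurable]: "(\<lambda>S. \<beta>Alg \<delta>\<^sub>q S (fst (S i))) \<in> borel_measurable Train"
        "(\<lambda>S. \<beta>Alg \<delta>\<^sub>p S (fst (S i))) \<in> borel_measurable Train"
        using that by (auto intro: Alg_meas)
      show ?thesis by measurable
    qed
    then show ?thesis
      unfolding emp_def[abs_def]
      by (intro borel_measurable_times borel_measurable_const borel_measurable_sum) auto
  qed

  \<comment> \<open>Every test label in its band puts the label vector into the uncertainty set, where the
     robust solution is feasible.\<close>
  have feasible: "measure P {z \<in> space P. \<beta>Alg \<delta>\<^sub>p S (fst z) \<le> snd z \<and> snd z \<le> \<beta>Alg \<delta>\<^sub>q S (fst z)} ^ CARD('m)
                    \<le> measure Test (E S)" if S: "S \<in> space Train" for S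
    unfolding Test_def
  proof (rule prob_product_event_ge)
    let ?A = "{z \<in> space P. \<beta>Alg \<delta>\<^sub>p S (fst z) \<le> snd z \<and> snd z \<le> \<beta>Alg \<delta>\<^sub>q S (fst z)}"
    have [measurable]: "(\<lambda>z. \<beta>Alg \<delta>\<^sub>p S (fst z)) \<in> borel_measurable P"
      "(\<lambda>z. \<beta>Alg \<delta>\<^sub>q S (fst z)) \<in> borel_measurable P"
      using S by (auto intro!: B_P Alg)
    show "?A \<in> sets P" by measurable
    show "E S \<in> sets (PiM UNIV (\<lambda>_. P))" using E_sets[OF S] by (simp add: Test_def)
    show "(\<Pi>\<^sub>E j\<in>UNIV. ?A) \<subseteq> E S"
    proof
      fix T :: "'m \<Rightarrow> (real ^ 'd) \<times> real"
      assume "T \<in> (\<Pi>\<^sub>E j\<in>UNIV. ?A)"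
      then have TA: "T j \<in> ?A" for j by auto
      have TX: "\<forall>j. fst (T j) \<in> X" using TA unfolding space_P by (simp add: mem_Times_iff)
      have "(\<chi> j. snd (T j)) \<in> U S (\<lambda>j. fst (T j))"
        using TA by (auto simp: U_def uncertainty_box_def min_le_iff_disj le_max_iff_disj)
      moreover have "\<forall>u\<in>U S (\<lambda>j. fst (T j)). F (\<pi>star (U S (\<lambda>j. fst (T j)))) u \<in> K"
        using opt[OF S TX] by (simp add: robust_optimal_def is_arg_min_def)
      moreover have "T \<in> space Test" using TA by (simp add: Test_def space_PiM PiE_iff)
      ultimately show "T \<in> E S" by (simp add: E_def)
    qed
  qed fact

  show ?thesis
  proof (cases "rademacher PX n B\<^sub>0 = \<top>")
    case True
    \<comment> \<open>The difference of extended reals is minus infinity, so its positive part vanishes.\<close>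
    have zero: "(0 :: ereal) ^ CARD('m) = 0"
    proof -
      have "(0 :: ereal) ^ CARD('m) = ereal (0 ^ CARD('m))"
        by (simp only: zero_ereal_def ereal_power)
      then show ?thesis by (simp add: zero_power zero_ereal_def)
    qed
    have "{S \<in> space Train. ereal (measure Test (E S)) \<ge> (max 0 (ereal (emp S)
            - ereal (8 / \<epsilon>) * enn2ereal (rademacher PX n B\<^sub>0) - ereal (2 * t))) ^ CARD('m)} = space Train"
      using \<open>\<epsilon> > 0\<close> True by (auto simp: top_ereal_def zero)
    then show ?thesis
      using Train.prob_space \<open>0 < \<delta>\<close> unfolding E_def emp_def t_def by simp
  next
    case False
    then obtain R where R: "rademacher PX n B\<^sub>0 = ennreal R" "R \<ge> 0"
      by (cases "rademacher PX n B\<^sub>0") auto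
    have R': "rademacher (distr P (restrict_space borel X) fst) n B\<^sub>0 = ennreal R"
      using R by (simp add: PX_def)
    have sup: "measurable_suprema (distr P (restrict_space borel X) fst) B\<^sub>0"
      using meas_sup(1) by (simp add: PX_def)
    \<comment> \<open>Each of the two ramp classes gets half of the failure probability; the second one is
       negated, as its deviation is needed in the opposite direction.\<close>
    have half: "0 < \<delta> / 2" "\<delta> / 2 < 1" using \<open>0 < \<delta>\<close> \<open>\<delta> < 1\<close> by auto
    have img_m: "(\<lambda>\<beta> z. ramp_minus \<epsilon> (snd z - \<beta> (fst z))) ` B\<^sub>0 =
        {\<lambda>(x, y). ramp_minus \<epsilon> (y - \<beta> x) |\<beta>. \<beta> \<in> B\<^sub>0}"
      by (auto simp: case_prod_beta')
    have img_p: "(\<lambda>\<beta> z. - ramp_plus \<epsilon> (snd z - \<beta> (fst z))) ` B\<^sub>0 =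
        (\<lambda>g z. - g z) ` {\<lambda>(x, y). ramp_plus \<epsilon> (y - \<beta> x) |\<beta>. \<beta> \<in> B\<^sub>0}"
      by (auto simp: case_prod_beta' image_def)
    obtain A1 where A1: "A1 \<in> sets Train" "measure Train A1 \<ge> 1 - \<delta> / 2"
      "\<And>S \<beta>. S \<in> A1 \<Longrightarrow> \<beta> \<in> B\<^sub>0 \<Longrightarrow>
         1 / real n * (\<Sum>i<n. ramp_minus \<epsilon> (snd (S i) - \<beta> (fst (S i))))
           - (\<integral>z. ramp_minus \<epsilon> (snd z - \<beta> (fst z)) \<partial>P) \<le> 2 * (1 / \<epsilon>) * R + t"
    proof (rule uniform_deviation_lipschitz[of P fst "restrict_space borel X" n B\<^sub>0
          "\<lambda>z s. ramp_minus \<epsilon> (snd z - s)" 0 "1 / \<epsilon>" R "\<delta> / 2"])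
      show "\<bar>ramp_minus \<epsilon> (snd z - r) - ramp_minus \<epsilon> (snd z - s)\<bar> \<le> 1 / \<epsilon> * \<bar>r - s\<bar>"
        for z :: "(real ^ 'd) \<times> real" and r s
        using ramp_lipschitz(1)[OF \<open>\<epsilon> > 0\<close>, of "snd z - r" "snd z - s"] by (simp add: abs_minus_commute)
      show "measurable_suprema P ((\<lambda>\<beta> z. ramp_minus \<epsilon> (snd z - \<beta> (fst z))) ` B\<^sub>0)"
        unfolding img_m by (rule meas_sup(2))
      show "(\<lambda>z. ramp_minus \<epsilon> (snd z - \<beta> (fst z))) \<in> borel_measurable P" if "\<beta> \<in> B\<^sub>0" for \<beta>
        using B_P[OF that] by measurable
      show "ramp_minus \<epsilon> (snd z - s) \<in> {0..0 + 1}" for z :: "(real ^ 'd) \<times> real" and s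
        using ramp_range(1) by simp
      fix A
      assume A: "A \<in> sets (PiM {..<n} (\<lambda>_. P))" "1 - \<delta> / 2 \<le> measure (PiM {..<n} (\<lambda>_. P)) A"
          "\<And>S \<beta>. S \<in> A \<Longrightarrow> \<beta> \<in> B\<^sub>0 \<Longrightarrow>
             1 / real n * (\<Sum>i<n. ramp_minus \<epsilon> (snd (S i) - \<beta> (fst (S i))))
               - (\<integral>z. ramp_minus \<epsilon> (snd z - \<beta> (fst z)) \<partial>P)
             \<le> 2 * (1 / \<epsilon>) * R + sqrt (ln (1 / (\<delta> / 2)) / (2 * real n))"
      show thesis
        by (rule that[of A]) (use A in \<open>simp_all add: Train_def t_def\<close>)
    qed (use P.prob_space_axioms fst_P n B_nonempty \<open>\<epsilon> > 0\<close> R' R sup half in auto)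
    obtain A2 where A2: "A2 \<in> sets Train" "measure Train A2 \<ge> 1 - \<delta> / 2"
      "\<And>S \<beta>. S \<in> A2 \<Longrightarrow> \<beta> \<in> B\<^sub>0 \<Longrightarrow>
         1 / real n * (\<Sum>i<n. - ramp_plus \<epsilon> (snd (S i) - \<beta> (fst (S i))))
           - (\<integral>z. - ramp_plus \<epsilon> (snd z - \<beta> (fst z)) \<partial>P) \<le> 2 * (1 / \<epsilon>) * R + t"
    proof (rule uniform_deviation_lipschitz[of P fst "restrict_space borel X" n B\<^sub>0
          "\<lambda>z s. - ramp_plus \<epsilon> (snd z - s)" "-1" "1 / \<epsilon>" R "\<delta> / 2"])
      show "\<bar>- ramp_plus \<epsilon> (snd z - r) - - ramp_plus \<epsilon> (snd z - s)\<bar> \<le> 1 / \<epsilon> * \<bar>r - s\<bar>"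
        for z :: "(real ^ 'd) \<times> real" and r s
        using ramp_lipschitz(2)[OF \<open>\<epsilon> > 0\<close>, of "snd z - s" "snd z - r"] by simp
      show "measurable_suprema P ((\<lambda>\<beta> z. - ramp_plus \<epsilon> (snd z - \<beta> (fst z))) ` B\<^sub>0)"
        unfolding img_p by (rule measurable_suprema_uminus[OF meas_sup(3)])
      show "(\<lambda>z. - ramp_plus \<epsilon> (snd z - \<beta> (fst z))) \<in> borel_measurable P" if "\<beta> \<in> B\<^sub>0" for \<beta>
        using B_P[OF that] by measurable
      show "- ramp_plus \<epsilon> (snd z - s) \<in> {- 1..- 1 + 1}" for z :: "(real ^ 'd) \<times> real" and s
        using ramp_range(2)[of \<epsilon> "snd z - s"] by simp
      fix A
      assume A: "A \<in> sets (PiM {..<n} (\<lambda>_. P))" "1 - \<delta> / 2 \<le> measure (PiM {..<n} (\<lambda>_. P)) A"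
          "\<And>S \<beta>. S \<in> A \<Longrightarrow> \<beta> \<in> B\<^sub>0 \<Longrightarrow>
             1 / real n * (\<Sum>i<n. - ramp_plus \<epsilon> (snd (S i) - \<beta> (fst (S i))))
               - (\<integral>z. - ramp_plus \<epsilon> (snd z - \<beta> (fst z)) \<partial>P)
             \<le> 2 * (1 / \<epsilon>) * R + sqrt (ln (1 / (\<delta> / 2)) / (2 * real n))"
      show thesis
        by (rule that[of A]) (use A in \<open>simp_all add: Train_def t_def\<close>)
    qed (use P.prob_space_axioms fst_P n B_nonempty \<open>\<epsilon> > 0\<close> R' R sup half in auto)
    define good where "good = {S \<in> space Train.
      (max 0 (emp S - 8 / \<epsilon> * R - 2 * t)) ^ CARD('m) \<le> measure Test (E S)}"
    have good_sets: "good \<in> sets Train"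
      unfolding good_def using emp_meas E_meas by measurable
    have "A1 \<inter> A2 \<subseteq> good"
    proof
      fix S assume S12: "S \<in> A1 \<inter> A2"
      then have S: "S \<in> space Train" using sets.sets_into_space[OF A1(1)] by auto
      have q: "\<beta>Alg \<delta>\<^sub>q S \<in> B\<^sub>0" and p: "\<beta>Alg \<delta>\<^sub>p S \<in> B\<^sub>0" using S by (auto intro: Alg)
      let ?b = "measure P {z \<in> space P. \<beta>Alg \<delta>\<^sub>p S (fst z) \<le> snd z \<and> snd z \<le> \<beta>Alg \<delta>\<^sub>q S (fst z)}"
      have "emp S = 1 / real n * (\<Sum>i<n. ramp_minus \<epsilon> (snd (S i) - \<beta>Alg \<delta>\<^sub>q S (fst (S i))))
                  + 1 / real n * (\<Sum>i<n. - ramp_plus \<epsilon> (snd (S i) - \<beta>Alg \<delta>\<^sub>p S (fst (S i))))"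
        unfolding emp_def by (simp add: sum_subtractf sum_negf right_diff_distrib)
      also have "\<dots> \<le> (\<integral>z. ramp_minus \<epsilon> (snd z - \<beta>Alg \<delta>\<^sub>q S (fst z)) \<partial>P)
          - (\<integral>z. ramp_plus \<epsilon> (snd z - \<beta>Alg \<delta>\<^sub>p S (fst z)) \<partial>P) + 2 * (2 * (1 / \<epsilon>) * R + t)"
        \<comment> \<open>Uniformity over \<open>B\<^sub>0\<close> is what permits the data-dependent predictors here.\<close>
        using A1(3)[of S, OF _ q] A2(3)[of S, OF _ p] S12 by simp
      also have "\<dots> \<le> ?b + 4 / \<epsilon> * R + 2 * t"
        using prob_band_ge_ramps[OF P.prob_space_axioms \<open>\<epsilon> > 0\<close> snd_P B_P[OF p] B_P[OF q]] by simp
      also have "4 / \<epsilon> * R \<le> 8 / \<epsilon> * R"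
        using R(2) \<open>\<epsilon> > 0\<close> by (intro mult_right_mono divide_right_mono) auto
      finally have "max 0 (emp S - 8 / \<epsilon> * R - 2 * t) \<le> ?b" by simp
      then have "(max 0 (emp S - 8 / \<epsilon> * R - 2 * t)) ^ CARD('m) \<le> ?b ^ CARD('m)"
        by (intro power_mono) auto
      also note feasible[OF S]
      finally show "S \<in> good" using S by (simp add: good_def)
    qed
    then have "measure Train (A1 \<inter> A2) \<le> measure Train good"
      by (intro Train.finite_measure_mono good_sets)
    moreover have "measure Train (A1 \<inter> A2) \<ge> 1 - \<delta>"
      using Train.finite_measure_Union'[OF A1(1) A2(1)] Train.finite_measure_Diff'[OF A2(1) A1(1)]
        A1(2) A2(2) Train.prob_le_1[of "A1 \<union> A2"] by (simp add: Int_commute)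
    moreover have "{S \<in> space Train. ereal (measure Test (E S)) \<ge> (max 0 (ereal (emp S)
            - ereal (8 / \<epsilon>) * enn2ereal (rademacher PX n B\<^sub>0) - ereal (2 * t))) ^ CARD('m)} = good"
    proof -
      have "(max 0 (ereal (emp S) - ereal (8 / \<epsilon>) * enn2ereal (rademacher PX n B\<^sub>0)
              - ereal (2 * t))) ^ CARD('m) = ereal ((max 0 (emp S - 8 / \<epsilon> * R - 2 * t)) ^ CARD('m))" for S
      proof -
        have "max 0 (ereal (emp S) - ereal (8 / \<epsilon>) * enn2ereal (rademacher PX n B\<^sub>0) - ereal (2 * t))
              = ereal (max 0 (emp S - 8 / \<epsilon> * R - 2 * t))"
          using R by (simp add: max_def zero_ereal_def)
        then show ?thesis by (simp only: ereal_power)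
      qed
      then show ?thesis by (simp add: good_def)
    qed
    ultimately show ?thesis unfolding E_def emp_def t_def by simp
  qed
qed

end
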